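(* For any integer $\gamma \geq 0$, the operad $\mathsf{Trias}_\gamma$ admits the following presentation. It is generated by $\{\dashv_a, \perp, \vdash_a : a \in [\gamma]\}$ (all generators being of arity $2$) and its space of relations is the space induced by the equivalence relation $\leftrightarrow_\gamma$ satisfying $$\perp \circ_1 \perp \;\leftrightarrow_\gamma\; \perp \circ_2 \perp,$$ $$\dashv_a \circ_1 \perp \;\leftrightarrow_\gamma\; \perp \circ_2 \dashv_a, \qquad a \in [\gamma],$$ $$\perp \circ_1 \vdash_a \;\leftrightarrow_\gamma\; \vdash_a \circ_2 \perp, \qquad a \in [\gamma],$$ $$\perp \circ_1 \dashv_a \;\leftrightarrow_\gamma\; \perp \circ_2 \vdash_a, \qquad a \in [\gamma],$$ $$\dashv_a \circ_1 \vdash_{a'} \;\leftrightarrow_\gamma\; \vdash_{a'} \circ_2 \dashv_a, \qquad a, a' \in [\gamma],$$ $$\dashv_a \circ_1 \dashv_b \;\leftrightarrow_\gamma\; \dashv_a \circ_2 \vdash_b, \qquad a < b \in [\gamma],$$ $$\vdash_a \circ_1 \dashv_b \;\leftrightarrow_\gamma\; \vdash_a \circ_2 \vdash_b, \qquad a < b \in [\gamma],$$ $$\dashv_b \circ_1 \dashv_a \;\leftrightarrow_\gamma\; \dashv_a \circ_2 \dashv_b, \qquad a < b \in [\gamma],$$ $$\vdash_a \circ_1 \vdash_b \;\leftrightarrow_\gamma\; \vdash_b \circ_2 \vdash_a, \qquad a < b \in [\gamma],$$ $$\dashv_d \circ_1 \dashv_d \;\leftrightarrow_\gamma\; \dashv_d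 \circ_2 \perp \;\leftrightarrow_\gamma\; \dashv_d \circ_2 \dashv_c \;\leftrightarrow_\gamma\; \dashv_d \circ_2 \vdash_c, \qquad c \leq d \in [\gamma],$$ $$\vdash_d \circ_1 \dashv_c \;\leftrightarrow_\gamma\; \vdash_d \circ_1 \vdash_c \;\leftrightarrow_\gamma\; \vdash_d \circ_1 \perp \;\leftrightarrow_\gamma\; \vdash_d \circ_2 \vdash_d, \qquad c \leq d \in [\gamma].$$
   Context: The ground field has characteristic zero; $[\gamma]=\{1,\dots,\gamma\}$. Operads are nonsymmetric, described by partial compositions $\circ_i$ and a unit. Let $\mathcal{M}_\gamma$ be the monoid on $\{0\} \cup [\gamma]$ with product $\max$, and $\mathsf{T}\mathcal{M}_\gamma$ the operad whose arity-$n$ component ($n\geq1$) has as basis all words of length $n$ on $\{0\} \cup [\gamma]$, with $u \circ_i v := u_1 \dots u_{i-1}\,\max(u_i, v_1) \dots \max(u_i, v_m)\, u_{i+1} \dots u_n$ and unit the word $0$. $\mathsf{Trias}_\gamma$ is the suboperad of $\mathsf{T}\mathcal{M}_\gamma$ generated by the words $0a$, $00$, $a0$, $a \in [\gamma]$. $\mathbf{Free}(S)$ is the free nonsymmetric operad on a graded set $S$: its basis consists of planar rooted trees whose internal nodes of arity $k$ are labeled by elements of $S$ of arity $k$, and $\mathfrak{s} \circ_i \mathfrak{t}$ grafts the root of $\mathfrak{t}$ on the $i$th leaf of $\mathfrak{s}$. An element of $S$ is identified with the tree having a single internal node with that label. A presentation of an operad $\mathcal{O}$ is a pair $(\mathfrak{G},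 \mathfrak{R})$, $\mathfrak{G}$ a graded set and $\mathfrak{R}$ a subspace of $\mathbf{Free}(\mathfrak{G})$, such that $\mathcal{O} \cong \mathbf{Free}(\mathfrak{G})/\langle\mathfrak{R}\rangle$, with $\langle \mathfrak{R}\rangle$ the operad ideal generated by $\mathfrak{R}$. The space induced by an equivalence relation $\leftrightarrow$ on trees (of equal arity) is the linear span of all $x - x'$ with $x \leftrightarrow x'$. *)

theory Defs
  imports Complex_Main "HOL-Library.Poly_Mapping"
begin

section \<open>Linear nonsymmetric operads\<close>

text \<open>
  Carriers are explicit, because suboperads and quotients are needed. The natural numbers passed
  to the operations are arities: \<open>pcomp P n m i\<close> is the partial composition
  \<open>\<circ>\<^sub>i : P(n) \<otimes> P(m) \<rightarrow> P(n + m - 1)\<close>, used for \<open>1 \<le> i \<le> n\<close> only.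
\<close>

record ('k, 'a) ns_operad =
  component :: "nat \<Rightarrow> 'a set"
  vzero :: "nat \<Rightarrow> 'a"
  vadd :: "nat \<Rightarrow> 'a \<Rightarrow> 'a \<Rightarrow> 'a"
  vscale :: "nat \<Rightarrow> 'k \<Rightarrow> 'a \<Rightarrow> 'a"
  pcomp :: "nat \<Rightarrow> nat \<Rightarrow> nat \<Rightarrow> 'a \<Rightarrow> 'a \<Rightarrow> 'a"
  opunit :: "'a"

locale ns_operad =
  fixes P :: "('k::field, 'a) ns_operad"
  assumes zero_closed: "vzero P n \<in> component P n"
    and add_closed: "\<lbrakk>x \<in> component P n; y \<in> component P n\<rbrakk> \<Longrightarrow> vadd P n x y \<in> component P n"
    and scale_closed: "x \<in> component P n \<Longrightarrow> vscale P n c x \<in> component P n"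
    and add_assoc: "\<lbrakk>x \<in> component P n; y \<in> component P n; z \<in> component P n\<rbrakk> \<Longrightarrow>
      vadd P n (vadd P n x y) z = vadd P n x (vadd P n y z)"
    and add_comm: "\<lbrakk>x \<in> component P n; y \<in> component P n\<rbrakk> \<Longrightarrow> vadd P n x y = vadd P n y x"
    and add_zero: "x \<in> component P n \<Longrightarrow> vadd P n x (vzero P n) = x"
    and add_inverse: "x \<in> component P n \<Longrightarrow> \<exists>y\<in>component P n. vadd P n x y = vzero P n"
    and scale_add: "\<lbrakk>x \<in> component P n; y \<in> component P n\<rbrakk> \<Longrightarrow>
      vscale P n c (vadd P n x y) = vadd P n (vscale P n c x) (vscale P n c y)"
    and add_scale: "x \<in> component P n \<Longrightarrow>
      vscale P n (c + d) x = vadd P n (vscale P n c x) (vscale P n d x)"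
    and scale_scale: "x \<in> component P n \<Longrightarrow> vscale P n c (vscale P n d x) = vscale P n (c * d) x"
    and scale_one: "x \<in> component P n \<Longrightarrow> vscale P n 1 x = x"
    and unit_closed: "opunit P \<in> component P 1"
    and comp_closed: "\<lbrakk>x \<in> component P n; y \<in> component P m; 1 \<le> i; i \<le> n\<rbrakk> \<Longrightarrow>
      pcomp P n m i x y \<in> component P (n + m - 1)"
    and comp_add_left:
      "\<lbrakk>x \<in> component P n; x' \<in> component P n; y \<in> component P m; 1 \<le> i; i \<le> n\<rbrakk> \<Longrightarrow>
      pcomp P n m i (vadd P n x x') y =
        vadd P (n + m - 1) (pcomp P n m i x y) (pcomp P n m i x' y)"
    and comp_add_right:
      "\<lbrakk>x \<in> component P n; y \<in> component P m; y' \<in> component P m; 1 \<le> i; i \<le> n\<rbrakk> \<Longrightarrow>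
      pcomp P n m i x (vadd P m y y') =
        vadd P (n + m - 1) (pcomp P n m i x y) (pcomp P n m i x y')"
    and comp_scale_left:
      "\<lbrakk>x \<in> component P n; y \<in> component P m; 1 \<le> i; i \<le> n\<rbrakk> \<Longrightarrow>
      pcomp P n m i (vscale P n c x) y = vscale P (n + m - 1) c (pcomp P n m i x y)"
    and comp_scale_right:
      "\<lbrakk>x \<in> component P n; y \<in> component P m; 1 \<le> i; i \<le> n\<rbrakk> \<Longrightarrow>
      pcomp P n m i x (vscale P m c y) = vscale P (n + m - 1) c (pcomp P n m i x y)"
    and comp_assoc_series:
      "\<lbrakk>x \<in> component P n; y \<in> component P m; z \<in> component P l; 1 \<le> i; i \<le> n; 1 \<le> j; j \<le> m\<rbrakk> \<Longrightarrow>
      pcomp P (n + m - 1) l (i + j - 1) (pcomp P n m i x y) z =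
        pcomp P n (m + l - 1) i x (pcomp P m l j y z)"
    and comp_assoc_parallel:
      "\<lbrakk>x \<in> component P n; y \<in> component P m; z \<in> component P l; 1 \<le> i; i < j; j \<le> n\<rbrakk> \<Longrightarrow>
      pcomp P (n + m - 1) l (j + m - 1) (pcomp P n m i x y) z =
        pcomp P (n + l - 1) m i (pcomp P n l j x z) y"
    and comp_unit_left: "x \<in> component P n \<Longrightarrow> pcomp P 1 n 1 (opunit P) x = x"
    and comp_unit_right:
      "\<lbrakk>x \<in> component P n; 1 \<le> i; i \<le> n\<rbrakk> \<Longrightarrow> pcomp P n 1 i x (opunit P) = x"

definition operad_iso ::
    "('k::field, 'a) ns_operad \<Rightarrow> ('k, 'b) ns_operad \<Rightarrow> (nat \<Rightarrow> 'a \<Rightarrow> 'b) \<Rightarrow> bool" where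
  "operad_iso P Q \<phi> \<longleftrightarrow>
    (\<forall>n. bij_betw (\<phi> n) (component P n) (component Q n)) \<and>
    (\<forall>n. \<forall>x\<in>component P n. \<forall>y\<in>component P n. \<phi> n (vadd P n x y) = vadd Q n (\<phi> n x) (\<phi> n y)) \<and>
    (\<forall>n c. \<forall>x\<in>component P n. \<phi> n (vscale P n c x) = vscale Q n c (\<phi> n x)) \<and>
    \<phi> 1 (opunit P) = opunit Q \<and>
    (\<forall>n m i. \<forall>x\<in>component P n. \<forall>y\<in>component P m. 1 \<le> i \<longrightarrow> i \<le> n \<longrightarrow>
      \<phi> (n + m - 1) (pcomp P n m i x y) = pcomp Q n m i (\<phi> n x) (\<phi> m y))"

definition graded_subspace :: "('k::field, 'a) ns_operad \<Rightarrow> (nat \<Rightarrow> 'a set) \<Rightarrow> bool" where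
  "graded_subspace P V \<longleftrightarrow> (\<forall>n.
    V n \<subseteq> component P n \<and> vzero P n \<in> V n \<and>
    (\<forall>x\<in>V n. \<forall>y\<in>V n. vadd P n x y \<in> V n) \<and>
    (\<forall>c. \<forall>x\<in>V n. vscale P n c x \<in> V n))"

definition is_suboperad :: "('k::field, 'a) ns_operad \<Rightarrow> (nat \<Rightarrow> 'a set) \<Rightarrow> bool" where
  "is_suboperad P Q \<longleftrightarrow> graded_subspace P Q \<and> opunit P \<in> Q 1 \<and>
    (\<forall>n m i. \<forall>x\<in>Q n. \<forall>y\<in>Q m. 1 \<le> i \<longrightarrow> i \<le> n \<longrightarrow> pcomp P n m i x y \<in> Q (n + m - 1))"

definition generated_suboperad ::
    "('k::field, 'a) ns_operad \<Rightarrow> (nat \<Rightarrow> 'a set) \<Rightarrow> ('k, 'a) ns_operad" where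
  "generated_suboperad P X =
    P\<lparr>component := \<lambda>n. \<Inter> {Q n | Q. is_suboperad P Q \<and> (\<forall>m. X m \<subseteq> Q m)}\<rparr>"

definition is_operad_ideal :: "('k::field, 'a) ns_operad \<Rightarrow> (nat \<Rightarrow> 'a set) \<Rightarrow> bool" where
  "is_operad_ideal P I \<longleftrightarrow> graded_subspace P I \<and>
    (\<forall>n m i. \<forall>x\<in>I n. \<forall>y\<in>component P m. 1 \<le> i \<longrightarrow> i \<le> n \<longrightarrow>
      pcomp P n m i x y \<in> I (n + m - 1)) \<and>
    (\<forall>n m i. \<forall>x\<in>component P n. \<forall>y\<in>I m. 1 \<le> i \<longrightarrow> i \<le> n \<longrightarrow>
      pcomp P n m i x y \<in> I (n + m - 1))"

definition generated_ideal ::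
    "('k::field, 'a) ns_operad \<Rightarrow> (nat \<Rightarrow> 'a set) \<Rightarrow> nat \<Rightarrow> 'a set" where
  "generated_ideal P R n = \<Inter> {I n | I. is_operad_ideal P I \<and> (\<forall>m. R m \<subseteq> I m)}"

definition operad_coset :: "('k, 'a) ns_operad \<Rightarrow> (nat \<Rightarrow> 'a set) \<Rightarrow> nat \<Rightarrow> 'a \<Rightarrow> 'a set" where
  "operad_coset P I n x = vadd P n x ` I n"

text \<open>
  The operations on cosets are unions over all choices of representatives; when \<open>I\<close> is an
  operad ideal all these choices give the same coset.
\<close>

definition quotient_operad ::
    "('k::field, 'a) ns_operad \<Rightarrow> (nat \<Rightarrow> 'a set) \<Rightarrow> ('k, 'a set) ns_operad" where
  "quotient_operad P I = \<lparr>
    component = \<lambda>n. operad_coset P I n ` component P n,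
    vzero = \<lambda>n. operad_coset P I n (vzero P n),
    vadd = \<lambda>n A B. \<Union>a\<in>A. \<Union>b\<in>B. operad_coset P I n (vadd P n a b),
    vscale = \<lambda>n c A. \<Union>a\<in>A. operad_coset P I n (vscale P n c a),
    pcomp = \<lambda>n m i A B. \<Union>a\<in>A. \<Union>b\<in>B. operad_coset P I (n + m - 1) (pcomp P n m i a b),
    opunit = operad_coset P I 1 (opunit P)\<rparr>"


section \<open>Operads with a distinguished basis\<close>

definition pm_scale :: "'k::field \<Rightarrow> ('b \<Rightarrow>\<^sub>0 'k) \<Rightarrow> ('b \<Rightarrow>\<^sub>0 'k)" where
  "pm_scale c p = Poly_Mapping.map ((*) c) p"

lemma lookup_pm_scale: "Poly_Mapping.lookup (pm_scale c p) b = c * Poly_Mapping.lookup p b"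
  by (simp add: pm_scale_def Poly_Mapping.map.rep_eq when_def)

lemma vector_space_pm_scale: "vector_space pm_scale"
  by unfold_locales
    (auto intro!: poly_mapping_eqI simp: lookup_pm_scale lookup_add algebra_simps)

definition bilinear_extension ::
    "('b \<Rightarrow> 'c \<Rightarrow> 'd) \<Rightarrow> ('b \<Rightarrow>\<^sub>0 'k::field) \<Rightarrow> ('c \<Rightarrow>\<^sub>0 'k) \<Rightarrow> ('d \<Rightarrow>\<^sub>0 'k)" where
  "bilinear_extension f p q =
    (\<Sum>u\<in>Poly_Mapping.keys p. \<Sum>v\<in>Poly_Mapping.keys q.
      Poly_Mapping.single (f u v) (Poly_Mapping.lookup p u * Poly_Mapping.lookup q v))"

text \<open>
  \<open>B n\<close> is a basis of the component of arity \<open>n\<close>, \<open>f i\<close> is the partial composition \<open>\<circ>\<^sub>i\<close> of basis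
  elements, and the basis element \<open>e\<close> is the unit.
\<close>

definition linear_operad ::
    "(nat \<Rightarrow> 'b set) \<Rightarrow> (nat \<Rightarrow> 'b \<Rightarrow> 'b \<Rightarrow> 'b) \<Rightarrow> 'b \<Rightarrow> ('k::field, 'b \<Rightarrow>\<^sub>0 'k) ns_operad" where
  "linear_operad B f e = \<lparr>
    component = \<lambda>n. {p. Poly_Mapping.keys p \<subseteq> B n},
    vzero = \<lambda>n. 0,
    vadd = \<lambda>n. (+),
    vscale = \<lambda>n. pm_scale,
    pcomp = \<lambda>n m i. bilinear_extension (f i),
    opunit = Poly_Mapping.single e 1\<rparr>"


section \<open>Free operads and presentations\<close>

datatype 'g tree = Leaf | Node 'g "'g tree list"

fun arity :: "'g tree \<Rightarrow> nat" where
  "arity Leaf = 1"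
| "arity (Node g ts) = sum_list (map arity ts)"

text \<open>\<open>graft i s t\<close> grafts \<open>t\<close> on the \<open>i\<close>th leaf of \<open>s\<close>, leaves being numbered from 1.\<close>

fun graft :: "nat \<Rightarrow> 'g tree \<Rightarrow> 'g tree \<Rightarrow> 'g tree"
  and graft_list :: "nat \<Rightarrow> 'g tree list \<Rightarrow> 'g tree \<Rightarrow> 'g tree list" where
  "graft i Leaf t = t"
| "graft i (Node g ss) t = Node g (graft_list i ss t)"
| "graft_list i [] t = []"
| "graft_list i (s # ss) t =
    (if i \<le> arity s then graft i s t # ss else s # graft_list (i - arity s) ss t)"

text \<open>A graded set is given by the set \<open>S n\<close> of its elements of arity \<open>n\<close>, for each \<open>n\<close>.\<close>

inductive_set trees :: "(nat \<Rightarrow> 'g set) \<Rightarrow> 'g tree set" for S :: "nat \<Rightarrow> 'g set" where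
  Leaf: "Leaf \<in> trees S"
| Node: "\<lbrakk>g \<in> S (length ts); \<forall>t\<in>set ts. t \<in> trees S\<rbrakk> \<Longrightarrow> Node g ts \<in> trees S"

definition free_operad :: "(nat \<Rightarrow> 'g set) \<Rightarrow> ('k::field, 'g tree \<Rightarrow>\<^sub>0 'k) ns_operad" where
  "free_operad S = linear_operad (\<lambda>n. {t \<in> trees S. arity t = n}) graft Leaf"

definition is_presentation ::
    "('k::field, 'a) ns_operad \<Rightarrow> (nat \<Rightarrow> 'g set) \<Rightarrow> (nat \<Rightarrow> ('g tree \<Rightarrow>\<^sub>0 'k) set) \<Rightarrow> bool" where
  "is_presentation P G R \<longleftrightarrow> ns_operad P \<and> graded_subspace (free_operad G) R \<and>
    (\<exists>\<phi>. operad_iso P (quotient_operad (free_operad G) (generated_ideal (free_operad G) R)) \<phi>)"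

definition induced_space ::
    "('g tree \<Rightarrow> 'g tree \<Rightarrow> bool) \<Rightarrow> nat \<Rightarrow> ('g tree \<Rightarrow>\<^sub>0 'k::field) set" where
  "induced_space E n = module.span pm_scale
    {Poly_Mapping.single x 1 - Poly_Mapping.single x' 1 | x x'.
      E x x' \<and> arity x = n \<and> arity x' = n}"


section \<open>The pluritriassociative operad\<close>

definition word_comp :: "nat \<Rightarrow> nat list \<Rightarrow> nat list \<Rightarrow> nat list" where
  "word_comp i u v = take (i - 1) u @ map (max (u ! (i - 1))) v @ drop i u"

definition TM :: "nat \<Rightarrow> ('k::field, nat list \<Rightarrow>\<^sub>0 'k) ns_operad" where
  "TM \<gamma> = linear_operad (\<lambda>n. {w. w \<noteq> [] \<and> length w = n \<and> set w \<subseteq> {0..\<gamma>}}) word_comp [0]"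

definition Trias :: "nat \<Rightarrow> ('k::field, nat list \<Rightarrow>\<^sub>0 'k) ns_operad" where
  "Trias \<gamma> = generated_suboperad (TM \<gamma>)
    (\<lambda>n. if n = 2 then (\<lambda>w. Poly_Mapping.single w 1) `
            ({[0, a] | a. a \<in> {1..\<gamma>}} \<union> {[0, 0]} \<union> {[a, 0] | a. a \<in> {1..\<gamma>}})
          else {})"

text \<open>\<open>Lft a\<close>, \<open>Mid\<close> and \<open>Rgt a\<close> stand for \<open>\<stileturn>\<^sub>a\<close>, \<open>\<bottom>\<close> and \<open>\<turnstile>\<^sub>a\<close>.\<close>

datatype trias_op = Lft nat | Mid | Rgt nat

definition trias_gens :: "nat \<Rightarrow> nat \<Rightarrow> trias_op set" where
  "trias_gens \<gamma> n =
    (if n = 2 then {Lft a | a. a \<in> {1..\<gamma>}} \<union> {Mid} \<union> {Rgt a | a. a \<in> {1..\<gamma>}} else {})"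

definition comp2 :: "trias_op \<Rightarrow> nat \<Rightarrow> trias_op \<Rightarrow> trias_op tree" where
  "comp2 g i h = graft i (Node g [Leaf, Leaf]) (Node h [Leaf, Leaf])"

inductive trias_rel :: "nat \<Rightarrow> trias_op tree \<Rightarrow> trias_op tree \<Rightarrow> bool" for \<gamma> :: nat where
  "trias_rel \<gamma> (comp2 Mid 1 Mid) (comp2 Mid 2 Mid)"
| "a \<in> {1..\<gamma>} \<Longrightarrow> trias_rel \<gamma> (comp2 (Lft a) 1 Mid) (comp2 Mid 2 (Lft a))"
| "a \<in> {1..\<gamma>} \<Longrightarrow> trias_rel \<gamma> (comp2 Mid 1 (Rgt a)) (comp2 (Rgt a) 2 Mid)"
| "a \<in> {1..\<gamma>} \<Longrightarrow> trias_rel \<gamma> (comp2 Mid 1 (Lft a)) (comp2 Mid 2 (Rgt a))"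
| "\<lbrakk>a \<in> {1..\<gamma>}; a' \<in> {1..\<gamma>}\<rbrakk> \<Longrightarrow>
    trias_rel \<gamma> (comp2 (Lft a) 1 (Rgt a')) (comp2 (Rgt a') 2 (Lft a))"
| "\<lbrakk>a \<in> {1..\<gamma>}; b \<in> {1..\<gamma>}; a < b\<rbrakk> \<Longrightarrow>
    trias_rel \<gamma> (comp2 (Lft a) 1 (Lft b)) (comp2 (Lft a) 2 (Rgt b))"
| "\<lbrakk>a \<in> {1..\<gamma>}; b \<in> {1..\<gamma>}; a < b\<rbrakk> \<Longrightarrow>
    trias_rel \<gamma> (comp2 (Rgt a) 1 (Lft b)) (comp2 (Rgt a) 2 (Rgt b))"
| "\<lbrakk>a \<in> {1..\<gamma>}; b \<in> {1..\<gamma>}; a < b\<rbrakk> \<Longrightarrow>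
    trias_rel \<gamma> (comp2 (Lft b) 1 (Lft a)) (comp2 (Lft a) 2 (Lft b))"
| "\<lbrakk>a \<in> {1..\<gamma>}; b \<in> {1..\<gamma>}; a < b\<rbrakk> \<Longrightarrow>
    trias_rel \<gamma> (comp2 (Rgt a) 1 (Rgt b)) (comp2 (Rgt b) 2 (Rgt a))"
| "d \<in> {1..\<gamma>} \<Longrightarrow> trias_rel \<gamma> (comp2 (Lft d) 1 (Lft d)) (comp2 (Lft d) 2 Mid)"
| "\<lbrakk>c \<in> {1..\<gamma>}; d \<in> {1..\<gamma>}; c \<le> d\<rbrakk> \<Longrightarrow>
    trias_rel \<gamma> (comp2 (Lft d) 2 Mid) (comp2 (Lft d) 2 (Lft c))"
| "\<lbrakk>c \<in> {1..\<gamma>}; d \<in> {1..\<gamma>}; c \<le> d\<rbrakk> \<Longrightarrow>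
    trias_rel \<gamma> (comp2 (Lft d) 2 (Lft c)) (comp2 (Lft d) 2 (Rgt c))"
| "\<lbrakk>c \<in> {1..\<gamma>}; d \<in> {1..\<gamma>}; c \<le> d\<rbrakk> \<Longrightarrow>
    trias_rel \<gamma> (comp2 (Rgt d) 1 (Lft c)) (comp2 (Rgt d) 1 (Rgt c))"
| "\<lbrakk>c \<in> {1..\<gamma>}; d \<in> {1..\<gamma>}; c \<le> d\<rbrakk> \<Longrightarrow>
    trias_rel \<gamma> (comp2 (Rgt d) 1 (Rgt c)) (comp2 (Rgt d) 1 Mid)"
| "d \<in> {1..\<gamma>} \<Longrightarrow> trias_rel \<gamma> (comp2 (Rgt d) 1 Mid) (comp2 (Rgt d) 2 (Rgt d))"

definition trias_equiv :: "nat \<Rightarrow> trias_op tree \<Rightarrow> trias_op tree \<Rightarrow> bool" where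
  "trias_equiv \<gamma> = equivclp (trias_rel \<gamma>)"

end

theory Submission
  imports Defs
begin

text \<open>
  Put \<open>\<stileturn>\<^sub>0 = \<turnstile>\<^sub>0 = \<bottom>\<close>. The relations then take the uniform shape
  \<open>(x \<turnstile>\<^sub>a y) \<stileturn>\<^sub>b z = x \<turnstile>\<^sub>a (y \<stileturn>\<^sub>b z)\<close>,
  \<open>x \<stileturn>\<^sub>a (y \<turnstile>\<^sub>b z) = (x \<stileturn>\<^sub>m y) \<stileturn>\<^sub>a z\<close>, \<open>x \<stileturn>\<^sub>a (y \<stileturn>\<^sub>b z) = (x \<stileturn>\<^sub>a y) \<stileturn>\<^sub>m z\<close>,
  \<open>(x \<stileturn>\<^sub>b y) \<turnstile>\<^sub>a z = x \<turnstile>\<^sub>a (y \<turnstile>\<^sub>m z)\<close>, \<open>(x \<turnstile>\<^sub>b y) \<turnstile>\<^sub>a z = x \<turnstile>\<^sub>m (y \<turnstile>\<^sub>a z)\<close>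
  with \<open>m = max a b\<close> and \<open>a, b \<ge> 0\<close>. Evaluating trees in \<open>TM\<close> gives the words that contain a \<open>0\<close>.
  By the last four relations, \<open>x \<stileturn>\<^sub>a T\<close> and \<open>T \<turnstile>\<^sub>a x\<close> depend only on the word of \<open>T\<close>:
  the letters \<open>c\<close> of that word are attached to \<open>x\<close> one at a time by \<open>\<stileturn>\<^sub>m\<close> (respectively \<open>\<turnstile>\<^sub>m\<close>) with
  \<open>m = max a c\<close>. Hence a tree of word \<open>u 0 v\<close>, with \<open>u\<close> free of \<open>0\<close>, is congruent to the tree that
  attaches to a leaf the letters of \<open>v\<close> on the right, then those of \<open>u\<close> on the left. So trees
  with equal words are congruent, and the kernel of the evaluation map is the ideal of relations.
\<close>

section \<open>Linear extensions\<close>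

text \<open>A finitely supported map is the finite sum of its monomials. Linear identities thus need
  checking on basis elements only, and \<open>B\<close> can restrict these, for instance to one
  arity.\<close>

lemma poly_mapping_span_induct [consumes 1, case_names zero single add]:
  fixes p :: "'b \<Rightarrow>\<^sub>0 'k::comm_monoid_add"
  assumes "Poly_Mapping.keys p \<subseteq> B"
    and zero: "Q 0"
    and single: "\<And>b c. b \<in> B \<Longrightarrow> Q (Poly_Mapping.single b c)"
    and add: "\<And>p q. Q p \<Longrightarrow> Q q \<Longrightarrow> Q (p + q)"
  shows "Q p"
proof -
  have sum: "Q (\<Sum>b\<in>A. Poly_Mapping.single b (Poly_Mapping.lookup p b))"
    if "finite A" "A \<subseteq> B" for A
    using that by (induction A rule: finite_induct) (auto intro: zero single add)
  have "p = (\<Sum>b\<in>Poly_Mapping.keys p. Poly_Mapping.single b (Poly_Mapping.lookup p b))"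
    by (rule poly_mapping_eqI)
      (simp add: lookup_sum lookup_single when_def sum.delta in_keys_iff)
  then show ?thesis using sum[OF finite_keys assms(1)] by simp
qed

lemmas poly_mapping_linear_induct [case_names zero single add] =
  poly_mapping_span_induct[OF subset_UNIV, simplified]

text \<open>Terms outside the supports have coefficient 0. Sums with different supports can
  therefore be compared over one common index set, which gives additivity.\<close>

lemma bilinear_extension_superset:
  fixes p :: "'b \<Rightarrow>\<^sub>0 'k::field" and q :: "'c \<Rightarrow>\<^sub>0 'k"
  assumes "finite A" "Poly_Mapping.keys p \<subseteq> A" "finite B" "Poly_Mapping.keys q \<subseteq> B"
  shows "bilinear_extension f p q = (\<Sum>u\<in>A. \<Sum>v\<in>B.
    Poly_Mapping.single (f u v) (Poly_Mapping.lookup p u * Poly_Mapping.lookup q v))"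
proof -
  have "(\<Sum>u\<in>A. \<Sum>v\<in>B.
      Poly_Mapping.single (f u v) (Poly_Mapping.lookup p u * Poly_Mapping.lookup q v)) =
    (\<Sum>u\<in>A. \<Sum>v\<in>Poly_Mapping.keys q.
      Poly_Mapping.single (f u v) (Poly_Mapping.lookup p u * Poly_Mapping.lookup q v))"
    using assms by (intro sum.cong refl sum.mono_neutral_right) (auto simp: in_keys_iff)
  also have "\<dots> = bilinear_extension f p q"
    unfolding bilinear_extension_def
    using assms by (intro sum.mono_neutral_right) (auto simp: in_keys_iff)
  finally show ?thesis by simp
qed

lemma bilinear_extension_add_left:
  "bilinear_extension f (p + p') q = bilinear_extension f p q + bilinear_extension f p' q"
proof -
  let ?A = "Poly_Mapping.keys p \<union> Poly_Mapping.keys p'"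
  show ?thesis
    by (subst (1 2 3) bilinear_extension_superset[where A = ?A and B = "Poly_Mapping.keys q"])
      (auto simp: Poly_Mapping.keys_add lookup_add distrib_right single_add sum.distrib)
qed

lemma bilinear_extension_add_right:
  "bilinear_extension f p (q + q') = bilinear_extension f p q + bilinear_extension f p q'"
proof -
  let ?B = "Poly_Mapping.keys q \<union> Poly_Mapping.keys q'"
  show ?thesis
    by (subst (1 2 3) bilinear_extension_superset[where A = "Poly_Mapping.keys p" and B = ?B])
      (auto simp: Poly_Mapping.keys_add lookup_add distrib_left single_add sum.distrib)
qed

lemma bilinear_extension_single [simp]:
  "bilinear_extension f (Poly_Mapping.single u a) (Poly_Mapping.single v b) =
    Poly_Mapping.single (f u v) (a * b)"
  by (subst bilinear_extension_superset[where A = "{u}" and B = "{v}"]) auto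

lemma bilinear_extension_zero [simp]:
  "bilinear_extension f 0 q = 0" "bilinear_extension f p 0 = 0"
  by (simp_all add: bilinear_extension_def)

lemma pm_scale_single [simp]:
  "pm_scale c (Poly_Mapping.single b d) = Poly_Mapping.single b (c * d)"
  by (rule poly_mapping_eqI) (simp add: lookup_pm_scale lookup_single when_def)

lemma pm_scale_zero [simp]: "pm_scale c 0 = 0"
  by (rule poly_mapping_eqI) (simp add: lookup_pm_scale)

lemma pm_scale_add: "pm_scale c (p + q) = pm_scale c p + pm_scale c q"
  by (rule poly_mapping_eqI) (simp add: lookup_pm_scale lookup_add distrib_left)

lemma pm_scale_diff: "pm_scale c (p - q) = pm_scale c p - pm_scale c q"
  by (rule poly_mapping_eqI) (simp add: lookup_pm_scale lookup_minus right_diff_distrib)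

lemma keys_pm_scale: "Poly_Mapping.keys (pm_scale c p) \<subseteq> Poly_Mapping.keys p"
  by (auto simp: in_keys_iff lookup_pm_scale)

lemma uminus_eq_pm_scale: "- p = pm_scale (- 1) p"
  by (rule poly_mapping_eqI) (simp add: lookup_pm_scale)

lemma bilinear_extension_scale_left:
  "bilinear_extension f (pm_scale c p) q = pm_scale c (bilinear_extension f p q)"
proof (induction p rule: poly_mapping_linear_induct)
  case (single u a)
  show ?case
    by (induction q rule: poly_mapping_linear_induct)
      (simp_all add: bilinear_extension_add_right pm_scale_add mult.assoc)
qed (simp_all add: bilinear_extension_add_left pm_scale_add)

lemma bilinear_extension_scale_right:
  "bilinear_extension f p (pm_scale c q) = pm_scale c (bilinear_extension f p q)"
proof (induction p rule: poly_mapping_linear_induct)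
  case (single u a)
  show ?case
    by (induction q rule: poly_mapping_linear_induct)
      (simp_all add: bilinear_extension_add_right pm_scale_add mult_ac)
qed (simp_all add: bilinear_extension_add_left pm_scale_add)

lemma bilinear_extension_diff_left:
  "bilinear_extension f (p - p') q = bilinear_extension f p q - bilinear_extension f p' q"
  using bilinear_extension_add_left[of f "p - p'" p' q] by simp

lemma bilinear_extension_diff_right:
  "bilinear_extension f p (q - q') = bilinear_extension f p q - bilinear_extension f p q'"
  using bilinear_extension_add_right[of f p "q - q'" q'] by simp

lemma keys_bilinear_extension:
  "Poly_Mapping.keys (bilinear_extension f p q) \<subseteq>
    {f u v | u v. u \<in> Poly_Mapping.keys p \<and> v \<in> Poly_Mapping.keys q}"
  unfolding bilinear_extension_def
  by (intro order_trans[OF Poly_Mapping.keys_sum] UN_least) (auto split: if_splits)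

lemma keys_bilinear_extension_subset:
  assumes "Poly_Mapping.keys p \<subseteq> A" "Poly_Mapping.keys q \<subseteq> B"
    and "\<And>u v. u \<in> A \<Longrightarrow> v \<in> B \<Longrightarrow> f u v \<in> C"
  shows "Poly_Mapping.keys (bilinear_extension f p q) \<subseteq> C"
  using keys_bilinear_extension[of f p q] assms by blast

text \<open>Pairing with the one-dimensional space on the unit type lets linearity be inherited from
  the bilinear case.\<close>

definition linear_extension :: "('b \<Rightarrow> 'c) \<Rightarrow> ('b \<Rightarrow>\<^sub>0 'k::field) \<Rightarrow> ('c \<Rightarrow>\<^sub>0 'k)" where
  "linear_extension g p = bilinear_extension (\<lambda>u _. g u) p (Poly_Mapping.single () 1)"

lemma linear_extension_simps [simp]:
  "linear_extension g 0 = 0"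
  "linear_extension g (Poly_Mapping.single b c) = Poly_Mapping.single (g b) c"
  by (simp_all add: linear_extension_def)

lemma linear_extension_add: "linear_extension g (p + q) = linear_extension g p + linear_extension g q"
  by (simp add: linear_extension_def bilinear_extension_add_left)

lemma linear_extension_diff: "linear_extension g (p - q) = linear_extension g p - linear_extension g q"
  by (simp add: linear_extension_def bilinear_extension_diff_left)

lemma linear_extension_scale: "linear_extension g (pm_scale c p) = pm_scale c (linear_extension g p)"
  by (simp add: linear_extension_def bilinear_extension_scale_left)

lemma keys_linear_extension: "Poly_Mapping.keys (linear_extension g p) \<subseteq> g ` Poly_Mapping.keys p"
  unfolding linear_extension_def by (rule order_trans[OF keys_bilinear_extension]) auto

text \<open>Both sides are bilinear in \<open>p\<close> and \<open>q\<close>, so multiplicativity on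
  basis elements suffices. The sets \<open>A\<close> and \<open>B\<close> hold the basis elements of
  the arities in question.\<close>

lemma linear_extension_bilinear_extension:
  assumes "\<And>u v. u \<in> A \<Longrightarrow> v \<in> B \<Longrightarrow> g (f u v) = h (g u) (g v)"
    and "Poly_Mapping.keys p \<subseteq> A" "Poly_Mapping.keys q \<subseteq> B"
  shows "linear_extension g (bilinear_extension f p q) =
    bilinear_extension h (linear_extension g p) (linear_extension g q)"
  using assms(2)
proof (induction p rule: poly_mapping_span_induct)
  case (single u a)
  show ?case using assms(3)
    by (induction q rule: poly_mapping_span_induct)
      (use single assms(1) in
        \<open>simp_all add: bilinear_extension_add_right linear_extension_add\<close>)
qed (simp_all add: bilinear_extension_add_left linear_extension_add)

section \<open>Operads with a basis\<close>

text \<open>Every operad axiom is multilinear, so it follows from its instances on basis elements,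
  by one induction for each argument.\<close>

lemma ns_operad_linear_operad:
  fixes B :: "nat \<Rightarrow> 'b set"
  assumes unit: "e \<in> B 1"
    and closed: "\<And>n m i u v. \<lbrakk>u \<in> B n; v \<in> B m; 1 \<le> i; i \<le> n\<rbrakk> \<Longrightarrow> f i u v \<in> B (n + m - 1)"
    and series: "\<And>n m l i j u v w.
      \<lbrakk>u \<in> B n; v \<in> B m; w \<in> B l; 1 \<le> i; i \<le> n; 1 \<le> j; j \<le> m\<rbrakk> \<Longrightarrow>
        f (i + j - 1) (f i u v) w = f i u (f j v w)"
    and parallel: "\<And>n m l i j u v w.
      \<lbrakk>u \<in> B n; v \<in> B m; w \<in> B l; 1 \<le> i; i < j; j \<le> n\<rbrakk> \<Longrightarrow>
        f (j + m - 1) (f i u v) w = f i (f j u w) v"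
    and unit_left: "\<And>n u. u \<in> B n \<Longrightarrow> f 1 e u = u"
    and unit_right: "\<And>n i u. \<lbrakk>u \<in> B n; 1 \<le> i; i \<le> n\<rbrakk> \<Longrightarrow> f i u e = u"
  shows "ns_operad (linear_operad B f e :: ('k::field, 'b \<Rightarrow>\<^sub>0 'k) ns_operad)"
proof -
  let ?F = "linear_operad B f e :: ('k, 'b \<Rightarrow>\<^sub>0 'k) ns_operad"
  have series': "bilinear_extension (f (i + j - 1)) (bilinear_extension (f i) x y) z =
      bilinear_extension (f i) x (bilinear_extension (f j) y z)"
    if "Poly_Mapping.keys x \<subseteq> B n" "Poly_Mapping.keys y \<subseteq> B m" "Poly_Mapping.keys z \<subseteq> B l"
      "1 \<le> i" "i \<le> n" "1 \<le> j" "j \<le> m" for x y z :: "'b \<Rightarrow>\<^sub>0 'k" and n m l i j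
    using that(1)
  proof (induction x rule: poly_mapping_span_induct)
    case x: (single u a)
    show ?case using that(2)
    proof (induction y rule: poly_mapping_span_induct)
      case y: (single v b)
      show ?case using that(3)
        by (induction z rule: poly_mapping_span_induct)
          (use x y that series[of u n v m _ l i j] in
            \<open>simp_all add: bilinear_extension_add_right mult.assoc\<close>)
    qed (simp_all add: bilinear_extension_add_left bilinear_extension_add_right)
  qed (simp_all add: bilinear_extension_add_left)
  have parallel': "bilinear_extension (f (j + m - 1)) (bilinear_extension (f i) x y) z =
      bilinear_extension (f i) (bilinear_extension (f j) x z) y"
    if "Poly_Mapping.keys x \<subseteq> B n" "Poly_Mapping.keys y \<subseteq> B m" "Poly_Mapping.keys z \<subseteq> B l"
      "1 \<le> i" "i < j" "j \<le> n" for x y z :: "'b \<Rightarrow>\<^sub>0 'k" and n m l i j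
    using that(1)
  proof (induction x rule: poly_mapping_span_induct)
    case x: (single u a)
    show ?case using that(2)
    proof (induction y rule: poly_mapping_span_induct)
      case y: (single v b)
      show ?case using that(3)
        by (induction z rule: poly_mapping_span_induct)
          (use x y that parallel[of u n v m _ l i j] in
            \<open>simp_all add: bilinear_extension_add_left bilinear_extension_add_right mult_ac\<close>)
    qed (simp_all add: bilinear_extension_add_left bilinear_extension_add_right)
  qed (simp_all add: bilinear_extension_add_left)
  have unit_left': "bilinear_extension (f 1) (Poly_Mapping.single e 1) x = x"
    if "Poly_Mapping.keys x \<subseteq> B n" for x :: "'b \<Rightarrow>\<^sub>0 'k" and n
    using that by (induction x rule: poly_mapping_span_induct)
      (use unit_left in \<open>simp_all add: bilinear_extension_add_right\<close>)
  have unit_right': "bilinear_extension (f i) x (Poly_Mapping.single e 1) = x"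
    if "Poly_Mapping.keys x \<subseteq> B n" "1 \<le> i" "i \<le> n" for x :: "'b \<Rightarrow>\<^sub>0 'k" and n i
    using that by (induction x rule: poly_mapping_span_induct)
      (use unit_right in \<open>simp_all add: bilinear_extension_add_left\<close>)
  interpret vector_space "pm_scale :: 'k \<Rightarrow> ('b \<Rightarrow>\<^sub>0 'k) \<Rightarrow> _"
    by (rule vector_space_pm_scale)
  have F: "component ?F n = {p. Poly_Mapping.keys p \<subseteq> B n}" "vzero ?F n = 0" "vadd ?F n = (+)"
    "vscale ?F n = pm_scale" "pcomp ?F n m i = bilinear_extension (f i)"
    "opunit ?F = Poly_Mapping.single e 1" for n m i
    by (simp_all add: linear_operad_def)
  show ?thesis
    unfolding ns_operad_def F
  proof (intro conjI allI impI)
    show "\<exists>y\<in>{p. Poly_Mapping.keys p \<subseteq> B n}. x + y = 0"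
      if "x \<in> {p. Poly_Mapping.keys p \<subseteq> B n}" for n and x :: "'b \<Rightarrow>\<^sub>0 'k"
      using that by (intro bexI[of _ "- x"]) auto
    show "x + y \<in> {p. Poly_Mapping.keys p \<subseteq> B n}"
      if "x \<in> {p. Poly_Mapping.keys p \<subseteq> B n}" "y \<in> {p. Poly_Mapping.keys p \<subseteq> B n}"
      for n and x y :: "'b \<Rightarrow>\<^sub>0 'k"
      using that Poly_Mapping.keys_add[of x y] by blast
    show "pm_scale c x \<in> {p. Poly_Mapping.keys p \<subseteq> B n}"
      if "x \<in> {p. Poly_Mapping.keys p \<subseteq> B n}" for n c and x :: "'b \<Rightarrow>\<^sub>0 'k"
      using that keys_pm_scale[of c x] by blast
    show "bilinear_extension (f i) x y \<in> {p. Poly_Mapping.keys p \<subseteq> B (n + m - 1)}"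
      if "x \<in> {p. Poly_Mapping.keys p \<subseteq> B n}" "y \<in> {p. Poly_Mapping.keys p \<subseteq> B m}" "1 \<le> i" "i \<le> n"
      for n m i and x y :: "'b \<Rightarrow>\<^sub>0 'k"
      by (intro CollectI keys_bilinear_extension_subset[of x "B n" y "B m"])
        (use that closed[of _ n _ m i] in auto)
  qed (use unit series' parallel' unit_left' unit_right' in
      \<open>simp_all add: bilinear_extension_add_left bilinear_extension_add_right
        bilinear_extension_scale_left bilinear_extension_scale_right add_ac
        scale_left_distrib scale_right_distrib del: One_nat_def\<close>)
qed

text \<open>First isomorphism theorem: the cosets of \<open>I\<close> are the fibres of the
  surjection \<open>\<Phi>\<close>, and \<open>p\<close> is sent to its fibre. An operation on two
  cosets can then be computed from any representatives.\<close>

lemma operad_iso_fibres: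
  fixes P :: "('k::field, 'a) ns_operad" and F :: "('k, 'b) ns_operad" and \<Phi> :: "'b \<Rightarrow> 'a"
  assumes onto: "\<And>n. \<Phi> ` component F n = component P n"
    and add: "\<And>n x y. \<lbrakk>x \<in> component F n; y \<in> component F n\<rbrakk> \<Longrightarrow>
      vadd F n x y \<in> component F n \<and> \<Phi> (vadd F n x y) = vadd P n (\<Phi> x) (\<Phi> y)"
    and scale: "\<And>n c x. x \<in> component F n \<Longrightarrow>
      vscale F n c x \<in> component F n \<and> \<Phi> (vscale F n c x) = vscale P n c (\<Phi> x)"
    and unit: "opunit F \<in> component F 1" "\<Phi> (opunit F) = opunit P"
    and comp: "\<And>n m i x y. \<lbrakk>x \<in> component F n; y \<in> component F m; 1 \<le> i; i \<le> n\<rbrakk> \<Longrightarrow>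
      pcomp F n m i x y \<in> component F (n + m - 1) \<and>
      \<Phi> (pcomp F n m i x y) = pcomp P n m i (\<Phi> x) (\<Phi> y)"
    and coset: "\<And>n x. x \<in> component F n \<Longrightarrow>
      operad_coset F I n x = {y \<in> component F n. \<Phi> y = \<Phi> x}"
  shows "operad_iso P (quotient_operad F I) (\<lambda>n p. {y \<in> component F n. \<Phi> y = p})"
    (is "operad_iso P ?Q ?\<phi>")
proof -
  have ex: "\<exists>x\<in>component F n. p = \<Phi> x" if "p \<in> component P n" for n p
    using that onto[of n] by blast
  have "bij_betw (?\<phi> n) (component P n) (component ?Q n)" for n
  proof (rule bij_betw_imageI)
    show "inj_on (?\<phi> n) (component P n)"
      by (rule inj_onI) (use ex in blast)
    have "component ?Q n = (\<lambda>x. ?\<phi> n (\<Phi> x)) ` component F n"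
      by (simp add: quotient_operad_def coset cong: image_cong)
    then show "?\<phi> n ` component P n = component ?Q n"
      by (simp add: onto[symmetric] image_image)
  qed
  moreover have "?\<phi> n (vadd P n p q) = vadd ?Q n (?\<phi> n p) (?\<phi> n q)"
    if pq: "p \<in> component P n" "q \<in> component P n" for n p q
  proof -
    obtain x y where "x \<in> component F n" "p = \<Phi> x" "y \<in> component F n" "q = \<Phi> y"
      using ex[OF pq(1)] ex[OF pq(2)] by blast
    then show ?thesis
      using add by (auto simp: quotient_operad_def coset)
  qed
  moreover have "?\<phi> n (vscale P n c p) = vscale ?Q n c (?\<phi> n p)"
    if pq: "p \<in> component P n" for n c p
  proof -
    obtain x where "x \<in> component F n" "p = \<Phi> x"
      using ex[OF pq] by blast
    then show ?thesis
      using scale by (auto simp: quotient_operad_def coset)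
  qed
  moreover have "?\<phi> 1 (opunit P) = opunit ?Q"
    using unit by (simp add: quotient_operad_def coset)
  moreover have "?\<phi> (n + m - 1) (pcomp P n m i p q) = pcomp ?Q n m i (?\<phi> n p) (?\<phi> m q)"
    if pq: "p \<in> component P n" "q \<in> component P m" "1 \<le> i" "i \<le> n" for n m i p q
  proof -
    obtain x y where "x \<in> component F n" "p = \<Phi> x" "y \<in> component F m" "q = \<Phi> y"
      using ex[OF pq(1)] ex[OF pq(2)] by blast
    then show ?thesis
      using comp pq by (auto simp: quotient_operad_def coset)
  qed
  ultimately show ?thesis
    unfolding operad_iso_def by blast
qed

section \<open>Evaluation of trees\<close>

text \<open>The generator \<open>g\<close> stands for the word
  \<open>[left_val g, right_val g]\<close>: 0a for \<open>Lft a\<close>, 00 for \<open>Mid\<close>,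
  a0 for \<open>Rgt a\<close>.\<close>

fun left_val :: "trias_op \<Rightarrow> nat" where
  "left_val (Rgt a) = a"
| "left_val _ = 0"

fun right_val :: "trias_op \<Rightarrow> nat" where
  "right_val (Lft a) = a"
| "right_val _ = 0"

text \<open>\<open>word t\<close> is the value in \<open>TM\<close> of a binary tree \<open>t\<close>; on other trees it is junk.\<close>

fun word :: "trias_op tree \<Rightarrow> nat list" where
  "word (Node g [s, t]) = map (max (left_val g)) (word s) @ map (max (right_val g)) (word t)"
| "word _ = [0]"

definition zero_words :: "nat \<Rightarrow> nat \<Rightarrow> nat list set" where
  "zero_words \<gamma> n = {w. length w = n \<and> set w \<subseteq> {0..\<gamma>} \<and> 0 \<in> set w}"

abbreviation trias_trees :: "nat \<Rightarrow> trias_op tree set" where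
  "trias_trees \<gamma> \<equiv> trees (trias_gens \<gamma>)"

lemma trias_gens_2:
  "trias_gens \<gamma> 2 = Lft ` {1..\<gamma>} \<union> {Mid} \<union> Rgt ` {1..\<gamma>}"
  by (auto simp: trias_gens_def)

lemma Node_in_trias_trees:
  assumes "g \<in> trias_gens \<gamma> 2" "s \<in> trias_trees \<gamma>" "t \<in> trias_trees \<gamma>"
  shows "Node g [s, t] \<in> trias_trees \<gamma>"
  using assms by (intro trees.Node) (auto simp: numeral_2_eq_2)

text \<open>All generators have arity 2, so every internal node has exactly two children.\<close>

lemma trias_tree_induct [consumes 1, case_names Leaf Node]:
  assumes "t \<in> trias_trees \<gamma>" "P Leaf"
    and "\<And>g s t. \<lbrakk>g \<in> trias_gens \<gamma> 2; s \<in> trias_trees \<gamma>; t \<in> trias_trees \<gamma>; P s; P t\<rbrakk> \<Longrightarrow>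
      P (Node g [s, t])"
  shows "P t"
  using assms(1)
proof (induction t rule: trees.induct)
  case (Node g ts)
  from Node(1) have "length ts = 2" by (auto simp: trias_gens_def split: if_splits)
  then obtain s t where "ts = [s, t]"
    by (auto simp: numeral_2_eq_2 length_Suc_conv)
  with Node show ?case by (auto intro!: assms(3) simp: numeral_2_eq_2)
qed (rule assms(2))

lemma length_word: "t \<in> trias_trees \<gamma> \<Longrightarrow> length (word t) = arity t"
  by (induction t rule: trias_tree_induct) auto

lemma arity_pos: "t \<in> trias_trees \<gamma> \<Longrightarrow> 1 \<le> arity t"
  by (induction t rule: trias_tree_induct) auto

text \<open>A generator has value 0 on at least one side, and a 0 in the subtree on that side
  survives.\<close>

lemma word_in_zero_words: "t \<in> trias_trees \<gamma> \<Longrightarrow> word t \<in> zero_words \<gamma> (arity t)"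
proof (induction t rule: trias_tree_induct)
  case (Node g s t)
  then show ?case
    by (cases g) (force simp: zero_words_def trias_gens_2)+
qed (simp add: zero_words_def)

section \<open>Partial composition of words and the action of \<open>max\<close>\<close>

lemma map_max_zero [simp]: "map (max (0::nat)) w = w"
  by (simp add: map_idI)

lemma map_max_map: "map (max a) (map (max (b::nat)) w) = map (max (max a b)) w"
  by (simp add: max.assoc)

lemma word_comp_append:
  assumes "i = Suc (length u)"
  shows "word_comp i (u @ x # w) v = u @ map (max x) v @ w"
  using assms by (simp add: word_comp_def nth_append)

lemma split_at:
  assumes "1 \<le> i" "i \<le> length u"
  obtains u1 x u2 where "u = u1 @ x # u2" "i = Suc (length u1)"
proof
  show "u = take (i - 1) u @ u ! (i - 1) # drop i u"
    using assms id_take_nth_drop[of "i - 1" u] by simp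
  show "i = Suc (length (take (i - 1) u))"
    using assms by simp
qed

text \<open>Associativity of \<open>max\<close> lets the common factor \<open>a\<close> be taken out
  of a composition.\<close>

lemma word_comp_map_append_left:
  assumes "1 \<le> i" "i \<le> length u"
  shows "word_comp i (map (max a) u @ w) v = map (max a) (word_comp i u v) @ w"
proof -
  obtain u1 x u2 where "u = u1 @ x # u2" "i = Suc (length u1)"
    using assms by (rule split_at)
  then show ?thesis
    by (simp add: word_comp_append map_max_map del: map_map)
qed

lemma word_comp_map_append_right:
  assumes "length w < i" "i \<le> length w + length u"
  shows "word_comp i (w @ map (max a) u) v = w @ map (max a) (word_comp (i - length w) u v)"
proof -
  obtain u1 x u2 where u: "u = u1 @ x # u2" "i - length w = Suc (length u1)"
    using assms by (auto intro: split_at[of "i - length w" u])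
  then have "i = Suc (length (w @ map (max a) u1))"
    using assms by simp
  with u show ?thesis
    using word_comp_append[of i "w @ map (max a) u1" "max a x"] by (simp add: word_comp_append map_max_map del: map_map)
qed

text \<open>Leaf \<open>i\<close> lies in the first subtree, or in the second one with its number
  lowered by the arity of the first. The third claim makes evaluation a morphism of operads.\<close>

lemma graft_trias_trees:
  assumes "s \<in> trias_trees \<gamma>" "t \<in> trias_trees \<gamma>" "1 \<le> i" "i \<le> arity s"
  shows "graft i s t \<in> trias_trees \<gamma>" "arity (graft i s t) = arity s + arity t - 1"
    and "word (graft i s t) = word_comp i (word s) (word t)"
proof -
  have "graft i s t \<in> trias_trees \<gamma> \<and> arity (graft i s t) = arity s + arity t - 1 \<and>
    word (graft i s t) = word_comp i (word s) (word t)"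
    using assms(1,3,4)
  proof (induction s arbitrary: i rule: trias_tree_induct)
    case Leaf
    then show ?case using assms(2) by (simp add: word_comp_def)
  next
    case (Node g s1 s2)
    note pos = arity_pos[OF Node(2)] arity_pos[OF Node(3)] arity_pos[OF assms(2)]
    show ?case
    proof (cases "i \<le> arity s1")
      case True
      with Node pos show ?thesis
        by (simp add: Node_in_trias_trees word_comp_map_append_left length_word)
    next
      case False
      with Node.prems have "1 \<le> i - arity s1" "i - arity s1 \<le> arity s2" by auto
      with Node.IH(2)[OF this] Node False pos show ?thesis
        by (simp add: Node_in_trias_trees word_comp_map_append_right length_word)
    qed
  qed
  then show "graft i s t \<in> trias_trees \<gamma>" "arity (graft i s t) = arity s + arity t - 1"
    "word (graft i s t) = word_comp i (word s) (word t)" by auto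
qed

section \<open>Normal forms\<close>

text \<open>The ideal of relations at the level of trees: relations with subtrees put on their three
  leaves, closed under contexts. In \<open>rel\<close> the leaves are filled from 3 down to 1, so
  that the numbers of those still free do not shift.\<close>

inductive trias_cong :: "nat \<Rightarrow> trias_op tree \<Rightarrow> trias_op tree \<Rightarrow> bool" for \<gamma> :: nat where
  refl: "t \<in> trias_trees \<gamma> \<Longrightarrow> trias_cong \<gamma> t t"
| sym: "trias_cong \<gamma> s t \<Longrightarrow> trias_cong \<gamma> t s"
| trans [trans]: "\<lbrakk>trias_cong \<gamma> r s; trias_cong \<gamma> s t\<rbrakk> \<Longrightarrow> trias_cong \<gamma> r t"
| node: "\<lbrakk>g \<in> trias_gens \<gamma> 2; trias_cong \<gamma> s s'; trias_cong \<gamma> t t'\<rbrakk> \<Longrightarrow>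
    trias_cong \<gamma> (Node g [s, t]) (Node g [s', t'])"
| rel: "\<lbrakk>trias_rel \<gamma> p q; x \<in> trias_trees \<gamma>; y \<in> trias_trees \<gamma>; z \<in> trias_trees \<gamma>\<rbrakk> \<Longrightarrow>
    trias_cong \<gamma> (graft 1 (graft 2 (graft 3 p z) y) x) (graft 1 (graft 2 (graft 3 q z) y) x)"

lemma comp2_simps:
  "comp2 g 1 h = Node g [Node h [Leaf, Leaf], Leaf]"
  "comp2 g (Suc 0) h = Node g [Node h [Leaf, Leaf], Leaf]"
  "comp2 g 2 h = Node g [Leaf, Node h [Leaf, Leaf]]"
  by (simp_all add: comp2_def)

text \<open>Soundness of the relations, checked one by one: both sides are trees with three leaves
  and have the same word.\<close>

lemma trias_rel_trees:
  assumes "trias_rel \<gamma> p q"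
  shows "p \<in> trias_trees \<gamma>" "q \<in> trias_trees \<gamma>" "arity p = 3" "arity q = 3" "word p = word q"
  using assms
  by (induction rule: trias_rel.induct)
    (auto simp: comp2_simps trias_gens_2 max_def intro!: Node_in_trias_trees trees.Leaf)

lemma trias_cong_trees:
  assumes "trias_cong \<gamma> s t"
  shows "s \<in> trias_trees \<gamma>" "t \<in> trias_trees \<gamma>" "arity s = arity t"
proof -
  have "s \<in> trias_trees \<gamma> \<and> t \<in> trias_trees \<gamma> \<and> arity s = arity t"
    using assms
  proof (induction rule: trias_cong.induct)
    case (rel p q x y z)
    note pq = trias_rel_trees[OF rel(1)]
    note graft = graft_trias_trees[where \<gamma> = \<gamma>] and pos = arity_pos[OF rel(3)] arity_pos[OF rel(4)]
    from rel pq pos show ?case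
      by (simp add: graft)
  qed (auto intro: Node_in_trias_trees)
  then show "s \<in> trias_trees \<gamma>" "t \<in> trias_trees \<gamma>" "arity s = arity t" by auto
qed

text \<open>\<open>lop 0 = rop 0 = Mid\<close> merges the families of relations.\<close>

definition lop :: "nat \<Rightarrow> trias_op" where
  "lop a = (if a = 0 then Mid else Lft a)"

definition rop :: "nat \<Rightarrow> trias_op" where
  "rop a = (if a = 0 then Mid else Rgt a)"

lemma lop_rop_gens: "a \<le> \<gamma> \<Longrightarrow> lop a \<in> trias_gens \<gamma> 2" "a \<le> \<gamma> \<Longrightarrow> rop a \<in> trias_gens \<gamma> 2"
  by (auto simp: lop_def rop_def trias_gens_2)

lemma val_simps [simp]:
  "left_val (lop a) = 0" "right_val (lop a) = a" "left_val (rop a) = a" "right_val (rop a) = 0"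
  by (auto simp: lop_def rop_def)

text \<open>\<open>Mid\<close> equals both \<open>lop 0\<close> and \<open>rop 0\<close>. It is put
  in the first case, so that the index in the second is positive; \<open>cong_normal_form\<close>
  relies on this.\<close>

lemma gens_cases:
  assumes "g \<in> trias_gens \<gamma> 2"
  obtains a where "a \<le> \<gamma>" "g = lop a" | a where "1 \<le> a" "a \<le> \<gamma>" "g = rop a"
proof -
  consider (l) a where "a \<in> {1..\<gamma>}" "g = Lft a" | (m) "g = Mid" | (r) a where "a \<in> {1..\<gamma>}" "g = Rgt a"
    using assms by (auto simp: trias_gens_2)
  then show thesis
  proof cases
    case l
    then show ?thesis using that(1)[of a] by (auto simp: lop_def)
  next
    case m
    then show ?thesis using that(1)[of 0] by (simp add: lop_def)
  next
    case r
    then show ?thesis using that(2)[of a] by (auto simp: rop_def)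
  qed
qed

section \<open>The uniform relations, for arbitrary subtrees and with index 0 allowed\<close>

context
  fixes \<gamma> :: nat and x y z :: "trias_op tree"
  assumes xyz: "x \<in> trias_trees \<gamma>" "y \<in> trias_trees \<gamma>" "z \<in> trias_trees \<gamma>"
begin

text \<open>The digits in the names of this lemma and the next two give the inputs that carry the
  inner operation on the two sides of the relation.\<close>

lemma rel_1_1:
  "trias_rel \<gamma> (comp2 g 1 h) (comp2 g' 1 h') \<Longrightarrow>
    trias_cong \<gamma> (Node g [Node h [x, y], z]) (Node g' [Node h' [x, y], z])"
  by (drule trias_cong.rel[OF _ xyz]) (simp add: comp2_simps)

lemma rel_1_2:
  "trias_rel \<gamma> (comp2 g 1 h) (comp2 g' 2 h') \<Longrightarrow>
    trias_cong \<gamma> (Node g [Node h [x, y], z]) (Node g' [x, Node h' [y, z]])"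
  by (drule trias_cong.rel[OF _ xyz]) (simp add: comp2_simps)

lemma rel_2_2:
  "trias_rel \<gamma> (comp2 g 2 h) (comp2 g' 2 h') \<Longrightarrow>
    trias_cong \<gamma> (Node g [x, Node h [y, z]]) (Node g' [x, Node h' [y, z]])"
  by (drule trias_cong.rel[OF _ xyz]) (simp add: comp2_simps)

text \<open>Four families of relations at once, one for each choice of which of \<open>a\<close> and
  \<open>b\<close> vanish.\<close>

lemma rop_lop:
  assumes "a \<le> \<gamma>" "b \<le> \<gamma>"
  shows "trias_cong \<gamma> (Node (lop b) [Node (rop a) [x, y], z]) (Node (rop a) [x, Node (lop b) [y, z]])"
  using assms by (intro rel_1_2) (auto simp: lop_def rop_def simp del: One_nat_def intro: trias_rel.intros)

text \<open>The chain of relations beginning with \<open>comp2 (Lft d) 1 (Lft d)\<close>, for d = a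
  and c = b. When b = 0, its term with \<open>Mid\<close> replaces those with index c.\<close>

lemma lop_lop_absorb:
  assumes "1 \<le> a" "b \<le> a" "a \<le> \<gamma>"
  shows "trias_cong \<gamma> (Node (Lft a) [x, Node (lop b) [y, z]]) (Node (Lft a) [Node (Lft a) [x, y], z])"
    and "trias_cong \<gamma> (Node (Lft a) [x, Node (rop b) [y, z]]) (Node (Lft a) [Node (Lft a) [x, y], z])"
proof -
  have mid: "trias_cong \<gamma> (Node (Lft a) [Node (Lft a) [x, y], z]) (Node (Lft a) [x, Node Mid [y, z]])"
    using assms by (intro rel_1_2 trias_rel.intros(10)) auto
  have lft: "trias_cong \<gamma> (Node (Lft a) [x, Node Mid [y, z]]) (Node (Lft a) [x, Node (lop b) [y, z]])"
  proof (cases "b = 0")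
    case True
    with trias_cong_trees(2)[OF mid] show ?thesis by (simp add: lop_def trias_cong.refl)
  next
    case False
    with assms show ?thesis
      by (simp add: lop_def) (intro rel_2_2 trias_rel.intros(11); simp)
  qed
  have rgt: "trias_cong \<gamma> (Node (Lft a) [x, Node (lop b) [y, z]]) (Node (Lft a) [x, Node (rop b) [y, z]])"
  proof (cases "b = 0")
    case True
    with trias_cong_trees(2)[OF mid] show ?thesis by (simp add: lop_def rop_def trias_cong.refl)
  next
    case False
    with assms show ?thesis
      by (simp add: lop_def rop_def) (intro rel_2_2 trias_rel.intros(12); simp)
  qed
  show "trias_cong \<gamma> (Node (Lft a) [x, Node (lop b) [y, z]]) (Node (Lft a) [Node (Lft a) [x, y], z])"
    "trias_cong \<gamma> (Node (Lft a) [x, Node (rop b) [y, z]]) (Node (Lft a) [Node (Lft a) [x, y], z])"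
    using mid lft rgt by (meson trias_cong.sym trias_cong.trans)+
qed

text \<open>Mirror image of \<open>lop_lop_absorb\<close>, from the chain that ends with
  \<open>comp2 (Rgt d) 2 (Rgt d)\<close>.\<close>

lemma rop_rop_absorb:
  assumes "1 \<le> a" "b \<le> a" "a \<le> \<gamma>"
  shows "trias_cong \<gamma> (Node (Rgt a) [Node (lop b) [x, y], z]) (Node (Rgt a) [x, Node (Rgt a) [y, z]])"
    and "trias_cong \<gamma> (Node (Rgt a) [Node (rop b) [x, y], z]) (Node (Rgt a) [x, Node (Rgt a) [y, z]])"
proof -
  have mid: "trias_cong \<gamma> (Node (Rgt a) [Node Mid [x, y], z]) (Node (Rgt a) [x, Node (Rgt a) [y, z]])"
    using assms by (intro rel_1_2 trias_rel.intros(15)) auto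
  have rgt: "trias_cong \<gamma> (Node (Rgt a) [Node (rop b) [x, y], z]) (Node (Rgt a) [Node Mid [x, y], z])"
  proof (cases "b = 0")
    case True
    with trias_cong_trees(1)[OF mid] show ?thesis by (simp add: rop_def trias_cong.refl)
  next
    case False
    with assms show ?thesis
      by (simp add: rop_def) (intro rel_1_1 trias_rel.intros(14); simp)
  qed
  have lft: "trias_cong \<gamma> (Node (Rgt a) [Node (lop b) [x, y], z]) (Node (Rgt a) [Node (rop b) [x, y], z])"
  proof (cases "b = 0")
    case True
    with trias_cong_trees(1)[OF mid] show ?thesis by (simp add: lop_def rop_def trias_cong.refl)
  next
    case False
    with assms show ?thesis
      by (simp add: lop_def rop_def) (intro rel_1_1 trias_rel.intros(13); simp)
  qed
  show "trias_cong \<gamma> (Node (Rgt a) [Node (lop b) [x, y], z]) (Node (Rgt a) [x, Node (Rgt a) [y, z]])"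
    "trias_cong \<gamma> (Node (Rgt a) [Node (rop b) [x, y], z]) (Node (Rgt a) [x, Node (Rgt a) [y, z]])"
    using mid lft rgt by (meson trias_cong.trans)+
qed

text \<open>For b \<le> a with a positive, the maximum is \<open>a\<close> and absorption applies.
  For a < b, and for a = b = 0, each identity is a single relation read backwards.\<close>

lemma lop_assoc:
  assumes "a \<le> \<gamma>" "b \<le> \<gamma>"
  shows "trias_cong \<gamma> (Node (lop a) [x, Node (lop b) [y, z]])
      (Node (lop (max a b)) [Node (lop a) [x, y], z])" (is ?lop)
    and "trias_cong \<gamma> (Node (lop a) [x, Node (rop b) [y, z]])
      (Node (lop a) [Node (lop (max a b)) [x, y], z])" (is ?rop)
proof -
  have "?lop \<and> ?rop"
  proof (cases "1 \<le> a \<and> b \<le> a")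
    case True
    with assms lop_lop_absorb[of a b] show ?thesis by (simp add: lop_def max_absorb1)
  next
    case False
    then have "a < b \<or> a = 0 \<and> b = 0" by auto
    then show ?thesis
      using assms
      by (intro conjI trias_cong.sym[OF rel_1_2])
        (auto simp: lop_def rop_def max_def simp del: One_nat_def intro: trias_rel.intros)
  qed
  then show ?lop ?rop by auto
qed

text \<open>Same case distinction as for \<open>lop_assoc\<close>, with left and right
  exchanged.\<close>

lemma rop_assoc:
  assumes "a \<le> \<gamma>" "b \<le> \<gamma>"
  shows "trias_cong \<gamma> (Node (rop a) [Node (lop b) [x, y], z])
      (Node (rop a) [x, Node (rop (max a b)) [y, z]])" (is ?lop)
    and "trias_cong \<gamma> (Node (rop a) [Node (rop b) [x, y], z])
      (Node (rop (max a b)) [x, Node (rop a) [y, z]])" (is ?rop)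
proof -
  have "?lop \<and> ?rop"
  proof (cases "1 \<le> a \<and> b \<le> a")
    case True
    with assms rop_rop_absorb[of a b] show ?thesis by (simp add: rop_def max_absorb1)
  next
    case False
    then have "a < b \<or> a = 0 \<and> b = 0" by auto
    then show ?thesis
      using assms
      by (intro conjI rel_1_2)
        (auto simp: lop_def rop_def max_def simp del: One_nat_def intro: trias_rel.intros)
  qed
  then show ?lop ?rop by auto
qed

end

section \<open>Attaching letters to a tree one at a time\<close>

definition attach_right :: "trias_op tree \<Rightarrow> nat list \<Rightarrow> trias_op tree" where
  "attach_right = foldl (\<lambda>s c. Node (lop c) [s, Leaf])"

text \<open>A right comb, whose first letter is outermost, while \<open>attach_right\<close> builds
  a left comb, whose first letter is innermost. In both the letters appear in the word of the result
  in their given order.\<close>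

definition attach_left :: "nat list \<Rightarrow> trias_op tree \<Rightarrow> trias_op tree" where
  "attach_left = foldr (\<lambda>c s. Node (rop c) [Leaf, s])"

lemma attach_simps [simp]:
  "attach_right s [] = s"
  "attach_right s (c # v) = attach_right (Node (lop c) [s, Leaf]) v"
  "attach_right s (v @ w) = attach_right (attach_right s v) w"
  "attach_left [] s = s"
  "attach_left (c # v) s = Node (rop c) [Leaf, attach_left v s]"
  "attach_left (v @ w) s = attach_left v (attach_left w s)"
  by (simp_all add: attach_right_def attach_left_def)

lemma attach_right_cong:
  "\<lbrakk>trias_cong \<gamma> s t; set v \<subseteq> {0..\<gamma>}\<rbrakk> \<Longrightarrow> trias_cong \<gamma> (attach_right s v) (attach_right t v)"
  by (induction v arbitrary: s t)
    (auto intro!: trias_cong.node trias_cong.refl trees.Leaf lop_rop_gens)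

lemma attach_left_cong:
  "\<lbrakk>trias_cong \<gamma> s t; set v \<subseteq> {0..\<gamma>}\<rbrakk> \<Longrightarrow> trias_cong \<gamma> (attach_left v s) (attach_left v t)"
  by (induction v) (auto intro!: trias_cong.node trias_cong.refl trees.Leaf lop_rop_gens)

text \<open>Congruence relates only trees over the generators, so membership follows by applying the
  two congruence lemmas to \<open>s\<close> and itself.\<close>

lemma attach_trees:
  assumes "s \<in> trias_trees \<gamma>" "set v \<subseteq> {0..\<gamma>}"
  shows "attach_right s v \<in> trias_trees \<gamma>" "attach_left v s \<in> trias_trees \<gamma>"
  using assms attach_right_cong attach_left_cong trias_cong.refl trias_cong_trees(1) by blast+

lemma map_max_word_le:
  "\<lbrakk>t \<in> trias_trees \<gamma>; a \<le> \<gamma>\<rbrakk> \<Longrightarrow> set (map (max a) (word t)) \<subseteq> {0..\<gamma>}"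
  using word_in_zero_words[of t \<gamma>] by (auto simp: zero_words_def)

text \<open>By \<open>lop_assoc\<close>, attaching a node to \<open>x\<close> amounts to attaching
  its two subtrees in turn. The second one is attached to a larger tree, possibly with another
  index, hence the induction over all \<open>x\<close> and \<open>a\<close>.\<close>

lemma lop_cong_attach_right:
  assumes "t \<in> trias_trees \<gamma>" "x \<in> trias_trees \<gamma>" "a \<le> \<gamma>"
  shows "trias_cong \<gamma> (Node (lop a) [x, t]) (attach_right x (map (max a) (word t)))"
  using assms
proof (induction t arbitrary: x a rule: trias_tree_induct)
  case Leaf
  then show ?case by (auto intro!: trias_cong.refl Node_in_trias_trees lop_rop_gens trees.Leaf)
next
  case (Node g s t)
  \<comment> \<open>The pair (c, d) will be (a, max a b) when \<open>g = lop b\<close> and (max a b,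
    a) when \<open>g = rop b\<close>.\<close>
  have step: "trias_cong \<gamma> (Node (lop d) [Node (lop c) [x, s], t])
      (attach_right x (map (max c) (word s) @ map (max d) (word t)))"
    if "c \<le> \<gamma>" "d \<le> \<gamma>" for c d
  proof -
    have "trias_cong \<gamma> (Node (lop d) [Node (lop c) [x, s], t])
        (attach_right (Node (lop c) [x, s]) (map (max d) (word t)))"
      using Node that by (intro Node.IH) (auto intro: Node_in_trias_trees lop_rop_gens)
    also have "trias_cong \<gamma> \<dots> (attach_right (attach_right x (map (max c) (word s))) (map (max d) (word t)))"
      using Node that by (intro attach_right_cong Node.IH map_max_word_le) auto
    finally show ?thesis by simp
  qed
  from Node(1) show ?case
  proof (cases rule: gens_cases)
    case (1 b)
    with Node have "trias_cong \<gamma> (Node (lop a) [x, Node g [s, t]])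
        (Node (lop (max a b)) [Node (lop a) [x, s], t])"
      by (simp add: lop_assoc)
    from trias_cong.trans[OF this step] 1 Node show ?thesis
      by (simp add: map_max_map del: map_map)
  next
    case (2 b)
    with Node have "trias_cong \<gamma> (Node (lop a) [x, Node g [s, t]])
        (Node (lop a) [Node (lop (max a b)) [x, s], t])"
      by (simp add: lop_assoc)
    from trias_cong.trans[OF this step] 2 Node show ?thesis
      by (simp add: map_max_map del: map_map)
  qed
qed

text \<open>Mirror image of \<open>lop_cong_attach_right\<close>, by \<open>rop_assoc\<close>: now
  the second subtree is attached to \<open>x\<close> first, and the first subtree to the
  result.\<close>

lemma rop_cong_attach_left:
  assumes "t \<in> trias_trees \<gamma>" "x \<in> trias_trees \<gamma>" "a \<le> \<gamma>"
  shows "trias_cong \<gamma> (Node (rop a) [t, x]) (attach_left (map (max a) (word t)) x)"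
  using assms
proof (induction t arbitrary: x a rule: trias_tree_induct)
  case Leaf
  then show ?case by (auto intro!: trias_cong.refl Node_in_trias_trees lop_rop_gens trees.Leaf)
next
  case (Node g s t)
  have step: "trias_cong \<gamma> (Node (rop c) [s, Node (rop d) [t, x]])
      (attach_left (map (max c) (word s) @ map (max d) (word t)) x)"
    if "c \<le> \<gamma>" "d \<le> \<gamma>" for c d
  proof -
    have "trias_cong \<gamma> (Node (rop c) [s, Node (rop d) [t, x]])
        (attach_left (map (max c) (word s)) (Node (rop d) [t, x]))"
      using Node that by (intro Node.IH) (auto intro: Node_in_trias_trees lop_rop_gens)
    also have "trias_cong \<gamma> \<dots> (attach_left (map (max c) (word s)) (attach_left (map (max d) (word t)) x))"
      using Node that by (intro attach_left_cong Node.IH map_max_word_le) auto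
    finally show ?thesis by simp
  qed
  from Node(1) show ?case
  proof (cases rule: gens_cases)
    case (1 b)
    with Node have "trias_cong \<gamma> (Node (rop a) [Node g [s, t], x])
        (Node (rop a) [s, Node (rop (max a b)) [t, x]])"
      by (simp add: rop_assoc)
    from trias_cong.trans[OF this step] 1 Node show ?thesis
      by (simp add: map_max_map del: map_map)
  next
    case (2 b)
    with Node have "trias_cong \<gamma> (Node (rop a) [Node g [s, t], x])
        (Node (rop (max a b)) [s, Node (rop a) [t, x]])"
      by (simp add: rop_assoc)
    from trias_cong.trans[OF this step] 2 Node show ?thesis
      by (simp add: map_max_map del: map_map)
  qed
qed

text \<open>\<open>rop_lop\<close> moves the right leaf past the letters of \<open>u\<close> one
  after another.\<close>

lemma attach_left_lop:
  assumes "s \<in> trias_trees \<gamma>" "c \<le> \<gamma>" "set u \<subseteq> {0..\<gamma>}"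
  shows "trias_cong \<gamma> (Node (lop c) [attach_left u s, Leaf]) (attach_left u (Node (lop c) [s, Leaf]))"
  using assms(3)
proof (induction u)
  case Nil
  then show ?case
    using assms by (auto intro!: trias_cong.refl Node_in_trias_trees lop_rop_gens trees.Leaf)
next
  case (Cons a u)
  then have "trias_cong \<gamma> (Node (lop c) [attach_left (a # u) s, Leaf])
      (Node (rop a) [Leaf, Node (lop c) [attach_left u s, Leaf]])"
    using assms by (auto intro!: rop_lop trees.Leaf attach_trees)
  also have "trias_cong \<gamma> \<dots> (Node (rop a) [Leaf, attach_left u (Node (lop c) [s, Leaf])])"
    using Cons by (auto intro!: trias_cong.node trias_cong.refl trees.Leaf lop_rop_gens)
  finally show ?case by simp
qed

lemma attach_left_right:
  assumes "s \<in> trias_trees \<gamma>" "set u \<subseteq> {0..\<gamma>}" "set v \<subseteq> {0..\<gamma>}"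
  shows "trias_cong \<gamma> (attach_right (attach_left u s) v) (attach_left u (attach_right s v))"
  using assms(1,3)
proof (induction v arbitrary: s)
  case Nil
  then show ?case using assms(2) by (auto intro!: trias_cong.refl attach_trees)
next
  case (Cons c v)
  then have "trias_cong \<gamma> (attach_right (attach_left u s) (c # v))
      (attach_right (attach_left u (Node (lop c) [s, Leaf])) v)"
    using assms(2) by (auto intro!: attach_right_cong attach_left_lop)
  also have "trias_cong \<gamma> \<dots> (attach_left u (attach_right (Node (lop c) [s, Leaf]) v))"
    using Cons by (auto intro!: Node_in_trias_trees lop_rop_gens trees.Leaf)
  finally show ?case by simp
qed

text \<open>The word is cut at its first 0, which becomes the initial leaf and is dropped by
  \<open>tl\<close>. Later zeros are attached on the right through
  \<open>lop 0 = Mid\<close>.\<close>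

definition normal_form :: "nat list \<Rightarrow> trias_op tree" where
  "normal_form w = attach_left (takeWhile (\<lambda>c. c \<noteq> 0) w)
    (attach_right Leaf (tl (dropWhile (\<lambda>c. c \<noteq> 0) w)))"

lemma normal_form_append:
  assumes "0 \<notin> set u"
  shows "normal_form (u @ 0 # v) = attach_left u (attach_right Leaf v)"
proof -
  have "takeWhile (\<lambda>c. c \<noteq> 0) (u @ 0 # v) = u" "dropWhile (\<lambda>c. c \<noteq> 0) (u @ 0 # v) = 0 # v"
    using assms by (auto simp: takeWhile_append dropWhile_append)
  then show ?thesis by (simp add: normal_form_def)
qed

lemma zero_wordsE:
  assumes "w \<in> zero_words \<gamma> n"
  obtains u v where "w = u @ 0 # v" "0 \<notin> set u" "set u \<subseteq> {0..\<gamma>}" "set v \<subseteq> {0..\<gamma>}"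
  using assms split_list_first[of 0 w] by (fastforce simp: zero_words_def)

lemma word_attach_right: "word (attach_right s v) = word s @ v"
  by (induction v arbitrary: s) auto

lemma word_attach_left: "word (attach_left u s) = u @ word s"
  by (induction u) auto

text \<open>\<open>normal_form\<close> is a section of \<open>word\<close>, so evaluation reaches
  every word that contains a 0.\<close>

lemma normal_form_zero_words:
  assumes "w \<in> zero_words \<gamma> n"
  shows "normal_form w \<in> trias_trees \<gamma>" "word (normal_form w) = w" "arity (normal_form w) = n"
proof -
  obtain u v where w: "w = u @ 0 # v" "0 \<notin> set u" "set u \<subseteq> {0..\<gamma>}" "set v \<subseteq> {0..\<gamma>}"
    using assms by (rule zero_wordsE)
  then show 1: "normal_form w \<in> trias_trees \<gamma>"
    by (simp add: normal_form_append attach_trees trees.Leaf)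
  from w show 2: "word (normal_form w) = w"
    by (simp add: normal_form_append word_attach_left word_attach_right)
  from assms 2 show "arity (normal_form w) = n"
    using length_word[OF 1] by (simp add: zero_words_def)
qed

text \<open>At a node \<open>lop b\<close> the first subtree holds the first 0 of the word, and the
  second dissolves into letters on its right. At a node \<open>rop b\<close> with b positive the
  roles are exchanged.\<close>

lemma cong_normal_form:
  assumes "t \<in> trias_trees \<gamma>"
  shows "trias_cong \<gamma> t (normal_form (word t))"
  using assms
proof (induction t rule: trias_tree_induct)
  case Leaf
  show ?case by (simp add: normal_form_def trias_cong.refl trees.Leaf)
next
  case (Node g s t)
  from Node(1) show ?case
  proof (cases rule: gens_cases)
    case (1 b)
    obtain u v where w: "word s = u @ 0 # v" "0 \<notin> set u" "set u \<subseteq> {0..\<gamma>}" "set v \<subseteq> {0..\<gamma>}"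
      using word_in_zero_words[OF Node(2)] by (rule zero_wordsE)
    let ?z = "map (max b) (word t)"
    have z: "set ?z \<subseteq> {0..\<gamma>}"
      using Node 1 by (intro map_max_word_le)
    have "trias_cong \<gamma> (Node (lop b) [s, t]) (attach_right s ?z)"
      using Node 1 by (intro lop_cong_attach_right)
    also have "trias_cong \<gamma> \<dots> (attach_right (attach_left u (attach_right Leaf v)) ?z)"
      using Node w z normal_form_append[of u v] by (intro attach_right_cong) simp_all
    \<comment> \<open>The new right letters pass below the left ones, as the normal form
      requires.\<close>
    also have "trias_cong \<gamma> \<dots> (attach_left u (attach_right (attach_right Leaf v) ?z))"
      using w z by (intro attach_left_right attach_trees trees.Leaf)
    finally show ?thesis
      using 1 w normal_form_append[of u "v @ ?z"] by simp
  next
    case (2 b)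
    obtain u v where w: "word t = u @ 0 # v" "0 \<notin> set u" "set u \<subseteq> {0..\<gamma>}" "set v \<subseteq> {0..\<gamma>}"
      using word_in_zero_words[OF Node(3)] by (rule zero_wordsE)
    let ?z = "map (max b) (word s)"
    have "trias_cong \<gamma> (Node (rop b) [s, t]) (attach_left ?z t)"
      using Node 2 by (intro rop_cong_attach_left)
    also have "trias_cong \<gamma> \<dots> (attach_left ?z (normal_form (word t)))"
      using Node 2 by (intro attach_left_cong map_max_word_le)
    finally have "trias_cong \<gamma> (Node g [s, t]) (attach_left (?z @ u) (attach_right Leaf v))"
      using 2 w normal_form_append[of u v] by simp
    \<comment> \<open>Since b \<ge> 1, no letter coming from \<open>s\<close> is 0, and the first 0
      is still the one in the word of \<open>t\<close>.\<close>
    moreover have "0 \<notin> set (?z @ u)"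
      using 2 w by (auto simp: max_def)
    ultimately show ?thesis
      using 2 w normal_form_append[of "?z @ u" v] by simp
  qed
qed

section \<open>The presentation\<close>

text \<open>If the replaced letter \<open>x\<close> is 0, then \<open>v\<close> is inserted
  unchanged and brings a 0; otherwise a 0 of \<open>u\<close> stands at another position and
  survives.\<close>

lemma zero_words_comp:
  assumes "u \<in> zero_words \<gamma> n" "v \<in> zero_words \<gamma> m" "1 \<le> i" "i \<le> n"
  shows "word_comp i u v \<in> zero_words \<gamma> (n + m - 1)"
proof -
  have "i \<le> length u" using assms by (simp add: zero_words_def)
  then obtain u1 x u2 where u: "u = u1 @ x # u2" "i = Suc (length u1)"
    using assms(3) by (elim split_at)
  have "set (map (max x) v) \<subseteq> {0..\<gamma>}"
    using assms u by (auto simp: zero_words_def)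
  moreover have "0 \<in> set (u1 @ map (max x) v @ u2)"
    using assms u by (cases "x = 0") (auto simp: zero_words_def simp flip: set_map)
  ultimately show ?thesis
    using assms u by (auto simp: zero_words_def word_comp_append)
qed

text \<open>Once the words are split at the letters composed, each axiom is an identity of
  concatenations; the series axiom also uses associativity of \<open>max\<close>.\<close>

lemma ns_operad_zero_words:
  "ns_operad (linear_operad (zero_words \<gamma>) word_comp [0] :: ('k::field, nat list \<Rightarrow>\<^sub>0 'k) ns_operad)"
proof (rule ns_operad_linear_operad)
  fix n m l i j u v w
  assume A: "u \<in> zero_words \<gamma> n" "v \<in> zero_words \<gamma> m" "w \<in> zero_words \<gamma> l"
    "1 \<le> i" "i \<le> n" "1 \<le> j" "j \<le> m"
  obtain u1 x u2 where u: "u = u1 @ x # u2" "i = Suc (length u1)"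
    using A split_at[of i u] by (auto simp: zero_words_def)
  obtain v1 y v2 where v: "v = v1 @ y # v2" "j = Suc (length v1)"
    using A split_at[of j v] by (auto simp: zero_words_def)
  show "word_comp (i + j - 1) (word_comp i u v) w = word_comp i u (word_comp j v w)"
    using u v word_comp_append[of "i + j - 1" "u1 @ map (max x) v1" "max x y"]
    by (simp add: word_comp_append map_max_map del: map_map)
next
  fix n m l i j u v w
  assume A: "u \<in> zero_words \<gamma> n" "v \<in> zero_words \<gamma> m" "w \<in> zero_words \<gamma> l"
    "1 \<le> i" "i < j" "j \<le> n"
  obtain u1 x u2 where u: "u = u1 @ x # u2" "i = Suc (length u1)"
    using A split_at[of i u] by (auto simp: zero_words_def)
  \<comment> \<open>As i < j, the letter of \<open>u\<close> at position \<open>j\<close> lies in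
    \<open>u2\<close>, at position \<open>j - i\<close> there.\<close>
  obtain u3 y u4 where u': "u2 = u3 @ y # u4" "j - i = Suc (length u3)"
  proof (rule split_at[of "j - i" u2])
    show "1 \<le> j - i" "j - i \<le> length u2"
      using A u by (auto simp: zero_words_def)
  qed
  have "word_comp (j + m - 1) (u1 @ map (max x) v @ u3 @ y # u4) w =
      u1 @ map (max x) v @ u3 @ map (max y) w @ u4"
  proof -
    have "length v = m" using A by (simp add: zero_words_def)
    moreover have "j = i + Suc (length u3)" using A u' by simp
    ultimately have "j + m - 1 = Suc (length (u1 @ map (max x) v @ u3))" using u by simp
    from word_comp_append[OF this] show ?thesis by simp
  qed
  moreover have "word_comp j (u1 @ x # u3 @ y # u4) w = u1 @ x # u3 @ map (max y) w @ u4"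
  proof -
    have "j = Suc (length (u1 @ x # u3))" using A u u' by simp
    from word_comp_append[OF this] show ?thesis by simp
  qed
  ultimately show "word_comp (j + m - 1) (word_comp i u v) w = word_comp i (word_comp j u w) v"
    using u u' by (simp add: word_comp_append)
next
  fix n i u
  assume A: "u \<in> zero_words \<gamma> n" "1 \<le> i" "i \<le> n"
  obtain u1 x u2 where "u = u1 @ x # u2" "i = Suc (length u1)"
    using A split_at[of i u] by (auto simp: zero_words_def)
  then show "word_comp i u [0] = u"
    by (simp add: word_comp_append)
next
  show "[0] \<in> zero_words \<gamma> 1"
    by (simp add: zero_words_def)
next
  show "word_comp 1 [0] u = u" for u
    by (simp add: word_comp_def)
qed (rule zero_words_comp)

section \<open>Words containing 0 as a basis of the generated suboperad\<close>

abbreviation trias_free :: "nat \<Rightarrow> ('k::field, trias_op tree \<Rightarrow>\<^sub>0 'k) ns_operad" where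
  "trias_free \<gamma> \<equiv> free_operad (trias_gens \<gamma>)"

lemma trias_free_simps [simp]:
  "p \<in> component (trias_free \<gamma>) n \<longleftrightarrow> Poly_Mapping.keys p \<subseteq> {t \<in> trias_trees \<gamma>. arity t = n}"
  "vzero (trias_free \<gamma>) n = 0"
  "vadd (trias_free \<gamma>) n = (+)"
  "vscale (trias_free \<gamma>) n = pm_scale"
  "pcomp (trias_free \<gamma>) n m i = bilinear_extension (graft i)"
  "opunit (trias_free \<gamma>) = Poly_Mapping.single Leaf 1"
  by (simp_all add: free_operad_def linear_operad_def)

lemma TM_simps [simp]:
  "p \<in> component (TM \<gamma>) n \<longleftrightarrow> Poly_Mapping.keys p \<subseteq> {w. w \<noteq> [] \<and> length w = n \<and> set w \<subseteq> {0..\<gamma>}}"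
  "vzero (TM \<gamma>) n = 0"
  "vadd (TM \<gamma>) n = (+)"
  "vscale (TM \<gamma>) n = pm_scale"
  "pcomp (TM \<gamma>) n m i = bilinear_extension (word_comp i)"
  "opunit (TM \<gamma>) = Poly_Mapping.single [0] 1"
  by (simp_all add: TM_def linear_operad_def)

lemma is_suboperad_zero_words:
  "is_suboperad (TM \<gamma> :: ('k::field, nat list \<Rightarrow>\<^sub>0 'k) ns_operad)
    (\<lambda>n. {p. Poly_Mapping.keys p \<subseteq> zero_words \<gamma> n})"
proof -
  have "bilinear_extension (word_comp i) p q \<in> {p. Poly_Mapping.keys p \<subseteq> zero_words \<gamma> (n + m - 1)}"
    if "Poly_Mapping.keys p \<subseteq> zero_words \<gamma> n" "Poly_Mapping.keys q \<subseteq> zero_words \<gamma> m" "1 \<le> i" "i \<le> n"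
    for n m i and p q :: "nat list \<Rightarrow>\<^sub>0 'k"
    by (intro CollectI keys_bilinear_extension_subset[of p "zero_words \<gamma> n" q "zero_words \<gamma> m"])
      (use that zero_words_comp[of _ \<gamma> n _ m i] in auto)
  moreover have "graded_subspace (TM \<gamma> :: ('k, nat list \<Rightarrow>\<^sub>0 'k) ns_operad)
      (\<lambda>n. {p. Poly_Mapping.keys p \<subseteq> zero_words \<gamma> n})"
  proof -
    have "zero_words \<gamma> n \<subseteq> {w. w \<noteq> [] \<and> length w = n \<and> set w \<subseteq> {0..\<gamma>}}" for n
      by (auto simp: zero_words_def)
    then have "{p :: nat list \<Rightarrow>\<^sub>0 'k. Poly_Mapping.keys p \<subseteq> zero_words \<gamma> n} \<subseteq> component (TM \<gamma>) n" for n
      using order_trans by (force simp: subset_iff)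
    then show ?thesis
      unfolding graded_subspace_def
      by (auto dest!: subsetD[OF Poly_Mapping.keys_add] subsetD[OF keys_pm_scale] simp del: TM_simps(1))
  qed
  ultimately show ?thesis
    unfolding is_suboperad_def by (simp add: zero_words_def)
qed

text \<open>A node is its generator with the two subtrees composed into it, so the word of a tree is
  built from words of generators by partial compositions.\<close>

lemma gen_word_in_suboperad:
  assumes Q: "is_suboperad (TM \<gamma> :: ('k::field, nat list \<Rightarrow>\<^sub>0 'k) ns_operad) Q"
    and gens: "\<And>g. g \<in> trias_gens \<gamma> 2 \<Longrightarrow> Poly_Mapping.single [left_val g, right_val g] 1 \<in> Q 2"
    and "t \<in> trias_trees \<gamma>"
  shows "Poly_Mapping.single (word t) 1 \<in> Q (arity t)"
  using assms(3)
proof (induction t rule: trias_tree_induct)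
  case Leaf
  then show ?case using Q by (simp add: is_suboperad_def)
next
  case (Node g s t)
  have comp: "Poly_Mapping.single (word_comp i u v) 1 \<in> Q (n + m - 1)"
    if "Poly_Mapping.single u 1 \<in> Q n" "Poly_Mapping.single v 1 \<in> Q m" "1 \<le> i" "i \<le> n" for u v n m i
  proof -
    have "\<forall>x\<in>Q n. \<forall>y\<in>Q m. bilinear_extension (word_comp i) x y \<in> Q (n + m - 1)"
      using Q that(3,4) by (simp add: is_suboperad_def)
    then have "bilinear_extension (word_comp i) (Poly_Mapping.single u 1) (Poly_Mapping.single v 1)
        \<in> Q (n + m - 1)"
      using that(1,2) by blast
    then show ?thesis by simp
  qed
  \<comment> \<open>Input 2 is filled first, so that input 1 keeps its position.\<close>
  have "Poly_Mapping.single (word_comp 2 [left_val g, right_val g] (word t)) 1 \<in> Q (2 + arity t - 1)"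
    using Node gens by (intro comp) auto
  then have "Poly_Mapping.single (left_val g # map (max (right_val g)) (word t)) 1 \<in> Q (Suc (arity t))"
    using word_comp_append[of 2 "[left_val g]" "right_val g" "[]"] by simp
  from comp[OF this Node(4), of 1] show ?case
    using word_comp_append[of 1 "[]"] by (simp add: add.commute)
qed

text \<open>The span of the words containing a 0 is one of the suboperads in the intersection.
  Conversely, each of these contains all such words, since they are values of trees.\<close>

lemma Trias_eq:
  "Trias \<gamma> = (linear_operad (zero_words \<gamma>) word_comp [0] :: ('k::field, nat list \<Rightarrow>\<^sub>0 'k) ns_operad)"
proof -
  let ?X = "\<lambda>n::nat. if n = 2 then (\<lambda>w. Poly_Mapping.single w (1::'k)) `
      ({[0, a] | a. a \<in> {1..\<gamma>}} \<union> {[0, 0]} \<union> {[a, 0] | a. a \<in> {1..\<gamma>}}) else {}"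
  let ?T = "TM \<gamma> :: ('k, nat list \<Rightarrow>\<^sub>0 'k) ns_operad"
  have "\<Inter> {Q n | Q. is_suboperad ?T Q \<and> (\<forall>m. ?X m \<subseteq> Q m)} =
      {p. Poly_Mapping.keys p \<subseteq> zero_words \<gamma> n}" (is "?L = ?R") for n
  proof (intro equalityI subsetI)
    fix p assume "p \<in> ?L"
    moreover have "?X m \<subseteq> {p. Poly_Mapping.keys p \<subseteq> zero_words \<gamma> m}" for m
      by (auto simp: zero_words_def)
    ultimately show "p \<in> ?R"
      using is_suboperad_zero_words by blast
  next
    fix p assume p: "p \<in> ?R"
    have "p \<in> Q n" if Q: "is_suboperad ?T Q" and X: "\<forall>m. ?X m \<subseteq> Q m" for Q
    proof -
      from X have "?X 2 \<subseteq> Q 2" by blast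
      then have gens: "Poly_Mapping.single [left_val g, right_val g] 1 \<in> Q 2"
        if "g \<in> trias_gens \<gamma> 2" for g
        using that by (auto simp: trias_gens_2)
      have word: "Poly_Mapping.single w 1 \<in> Q n" if "w \<in> zero_words \<gamma> n" for w
        using gen_word_in_suboperad[OF Q gens normal_form_zero_words(1)[OF that]]
        by (simp add: normal_form_zero_words[OF that])
      have sub: "0 \<in> Q n" "\<And>x y. x \<in> Q n \<Longrightarrow> y \<in> Q n \<Longrightarrow> x + y \<in> Q n"
        "\<And>c x. x \<in> Q n \<Longrightarrow> pm_scale c x \<in> Q n"
        using Q by (auto simp: is_suboperad_def graded_subspace_def)
      from p have "Poly_Mapping.keys p \<subseteq> zero_words \<gamma> n" by simp
      then show "p \<in> Q n"
      proof (induction p rule: poly_mapping_span_induct)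
        case (single w c)
        from sub(3)[OF word[OF this], of c] show ?case by simp
      qed (use sub in auto)
    qed
    then show "p \<in> ?L" by blast
  qed
  then show ?thesis
    unfolding Trias_def generated_suboperad_def by (simp add: TM_def linear_operad_def)
qed

section \<open>The kernel of evaluation and the ideal of relations\<close>

lemma trias_equiv_cases:
  assumes "trias_equiv \<gamma> s t"
  shows "s = t \<or> s \<in> trias_trees \<gamma> \<and> t \<in> trias_trees \<gamma> \<and> word s = word t"
  using assms unfolding trias_equiv_def
  by (induction rule: equivclp_induct) (auto dest: trias_rel_trees)

lemma free_comp_closed:
  assumes "p \<in> component (trias_free \<gamma>) n" "q \<in> component (trias_free \<gamma>) m" "1 \<le> i" "i \<le> n"
  shows "bilinear_extension (graft i) p q \<in> component (trias_free \<gamma>) (n + m - 1)"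
proof -
  have "Poly_Mapping.keys (bilinear_extension (graft i) p q) \<subseteq>
      {t \<in> trias_trees \<gamma>. arity t = n + m - 1}"
    by (rule keys_bilinear_extension_subset[of p "{t \<in> trias_trees \<gamma>. arity t = n}"
          q "{t \<in> trias_trees \<gamma>. arity t = m}"])
      (use assms graft_trias_trees[where \<gamma> = \<gamma>] in auto)
  then show ?thesis by simp
qed

lemma word_comp_extension:
  assumes "p \<in> component (trias_free \<gamma>) n" "q \<in> component (trias_free \<gamma>) m" "1 \<le> i" "i \<le> n"
  shows "linear_extension word (bilinear_extension (graft i) p q) =
    bilinear_extension (word_comp i) (linear_extension word p) (linear_extension word q)"
  using assms
  by (intro linear_extension_bilinear_extension[of "{t \<in> trias_trees \<gamma>. arity t = n}"
        "{t \<in> trias_trees \<gamma>. arity t = m}"]) (auto simp: graft_trias_trees)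

definition word_kernel :: "nat \<Rightarrow> nat \<Rightarrow> (trias_op tree \<Rightarrow>\<^sub>0 'k::field) set" where
  "word_kernel \<gamma> n = {p \<in> component (trias_free \<gamma>) n. linear_extension word p = 0}"

lemma word_kernel_ideal:
  "is_operad_ideal (trias_free \<gamma>) (word_kernel \<gamma> :: nat \<Rightarrow> (_ \<Rightarrow>\<^sub>0 'k::field) set)"
proof -
  have "graded_subspace (trias_free \<gamma>) (word_kernel \<gamma> :: nat \<Rightarrow> (_ \<Rightarrow>\<^sub>0 'k) set)"
    unfolding graded_subspace_def word_kernel_def
    by (auto simp: linear_extension_add linear_extension_scale
        dest!: subsetD[OF Poly_Mapping.keys_add] subsetD[OF keys_pm_scale])
  moreover have "bilinear_extension (graft i) x y \<in> word_kernel \<gamma> (n + m - 1)"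
    if "x \<in> component (trias_free \<gamma>) n" "y \<in> component (trias_free \<gamma>) m" "1 \<le> i" "i \<le> n"
      "x \<in> word_kernel \<gamma> n \<or> y \<in> word_kernel \<gamma> m" for n m i and x y :: "trias_op tree \<Rightarrow>\<^sub>0 'k"
    using that(5) free_comp_closed[OF that(1-4)] word_comp_extension[OF that(1-4)]
    by (auto simp: word_kernel_def simp del: trias_free_simps(1))
  moreover have "word_kernel \<gamma> n \<subseteq> component (trias_free \<gamma>) n" for n
    by (auto simp: word_kernel_def simp del: trias_free_simps(1))
  ultimately show ?thesis
    unfolding is_operad_ideal_def trias_free_simps(5) by blast
qed

lemma induced_space_subset_kernel:
  "induced_space (trias_equiv \<gamma>) n \<subseteq> (word_kernel \<gamma> n :: (trias_op tree \<Rightarrow>\<^sub>0 'k::field) set)"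
proof -
  interpret vector_space "pm_scale :: 'k \<Rightarrow> (trias_op tree \<Rightarrow>\<^sub>0 'k) \<Rightarrow> _"
    by (rule vector_space_pm_scale)
  show ?thesis
    unfolding induced_space_def
  proof (rule span_minimal)
    show "subspace (word_kernel \<gamma> n :: (trias_op tree \<Rightarrow>\<^sub>0 'k) set)"
      using word_kernel_ideal[of \<gamma>]
      by (auto simp: is_operad_ideal_def graded_subspace_def subspace_def)
    have "Poly_Mapping.single x 1 - Poly_Mapping.single x' (1::'k) \<in> word_kernel \<gamma> n"
      if "trias_equiv \<gamma> x x'" "arity x = n" "arity x' = n" for x x'
    \<comment> \<open>By reflexivity the equivalence also relates each tree outside the free operad
      to itself; such pairs contribute only the difference 0.\<close>
    proof (cases "x = x'")
      case False
      with trias_equiv_cases[OF that(1)] that(2,3) show ?thesis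
        by (auto simp: word_kernel_def linear_extension_diff dest!: subsetD[OF keys_diff])
    qed (simp add: word_kernel_def)
    then show "{Poly_Mapping.single x 1 - Poly_Mapping.single x' (1::'k) |x x'.
        trias_equiv \<gamma> x x' \<and> arity x = n \<and> arity x' = n} \<subseteq> word_kernel \<gamma> n"
      by blast
  qed
qed

text \<open>A span is closed under the linear operations, and it lies in the free operad because it
  lies in the kernel of evaluation.\<close>

lemma graded_subspace_induced_space:
  "graded_subspace (trias_free \<gamma>) (induced_space (trias_equiv \<gamma>) :: nat \<Rightarrow> (_ \<Rightarrow>\<^sub>0 'k::field) set)"
proof -
  interpret vector_space "pm_scale :: 'k \<Rightarrow> (trias_op tree \<Rightarrow>\<^sub>0 'k) \<Rightarrow> _"
    by (rule vector_space_pm_scale)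
  show ?thesis
    unfolding graded_subspace_def
  proof (intro allI conjI)
    show "(induced_space (trias_equiv \<gamma>) n :: (_ \<Rightarrow>\<^sub>0 'k) set) \<subseteq> component (trias_free \<gamma>) n" for n
      using induced_space_subset_kernel by (fastforce simp: word_kernel_def simp del: trias_free_simps(1))
  qed (auto simp: induced_space_def span_zero span_add span_scale)
qed

text \<open>Each rule of the congruence matches a closure property of ideals: symmetry is scaling by
  -1, transitivity is addition, and contexts and substitutions are compositions on the right and on
  the left.\<close>

lemma trias_cong_in_ideal:
  fixes I :: "nat \<Rightarrow> (trias_op tree \<Rightarrow>\<^sub>0 'k::field) set"
  assumes I: "is_operad_ideal (trias_free \<gamma>) I"
    and R: "\<And>n. induced_space (trias_equiv \<gamma>) n \<subseteq> I n"
    and "trias_cong \<gamma> s t"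
  shows "Poly_Mapping.single s 1 - Poly_Mapping.single t 1 \<in> I (arity s)"
proof -
  have sub: "0 \<in> I n" "\<And>x y. x \<in> I n \<Longrightarrow> y \<in> I n \<Longrightarrow> x + y \<in> I n"
    "\<And>c x. x \<in> I n \<Longrightarrow> pm_scale c x \<in> I n" for n
    using I by (auto simp: is_operad_ideal_def graded_subspace_def)
  let ?d = "\<lambda>s t. Poly_Mapping.single s 1 - Poly_Mapping.single t (1::'k)"
  have left: "?d (graft i s r) (graft i t r) \<in> I (n + arity r - 1)"
    if "?d s t \<in> I n" "r \<in> trias_trees \<gamma>" "1 \<le> i" "i \<le> n" for s t r i n
  proof -
    have "bilinear_extension (graft i) (?d s t) (Poly_Mapping.single r 1) \<in> I (n + arity r - 1)"
      using I that unfolding is_operad_ideal_def by (simp add: Ball_def)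
    then show ?thesis by (simp add: bilinear_extension_diff_left)
  qed
  have right: "?d (graft i r s) (graft i r t) \<in> I (arity r + n - 1)"
    if "?d s t \<in> I n" "r \<in> trias_trees \<gamma>" "1 \<le> i" "i \<le> arity r" for s t r i n
  proof -
    have "bilinear_extension (graft i) (Poly_Mapping.single r 1) (?d s t) \<in> I (arity r + n - 1)"
      using I that unfolding is_operad_ideal_def by (simp add: Ball_def)
    then show ?thesis by (simp add: bilinear_extension_diff_right)
  qed
  show ?thesis
    using assms(3)
  proof (induction rule: trias_cong.induct)
    case (refl t)
    then show ?case using sub by simp
  next
    case (sym s t)
    then show ?case
      using sub(3)[of "?d s t" "arity t" "- 1"] trias_cong_trees(3)[OF sym(1)]
      by (simp add: uminus_eq_pm_scale[symmetric])
  next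
    case (trans r s t)
    then show ?case
      using sub(2)[of "?d r s" "arity r" "?d s t"] trias_cong_trees(3)[OF trans(1)] by simp
  next
    case (node g s s' t t')
    note trees = trias_cong_trees[OF node(2)] trias_cong_trees[OF node(3)]
    have "Node g [Leaf, t] \<in> trias_trees \<gamma>" "Node g [s', Leaf] \<in> trias_trees \<gamma>"
      using node(1) trees by (auto intro: Node_in_trias_trees trees.Leaf)
    \<comment> \<open>One child is changed at a time. After the first change the remaining free leaf
      follows those of \<open>s'\<close>, hence its number \<open>arity s' + 1\<close>.\<close>
    note right[OF node(4) this(1), of 1] right[OF node(5) this(2), of "arity s' + 1"]
    with sub(2)[of "?d (Node g [s, t]) (Node g [s', t])" "arity s + arity t"
        "?d (Node g [s', t]) (Node g [s', t'])"] trees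
    show ?case by (simp add: add.commute)
  next
    case (rel p q x y z)
    note pq = trias_rel_trees[OF rel(1)]
    interpret vector_space "pm_scale :: 'k \<Rightarrow> (trias_op tree \<Rightarrow>\<^sub>0 'k) \<Rightarrow> _"
      by (rule vector_space_pm_scale)
    have "trias_equiv \<gamma> p q"
      using rel(1) by (auto simp: trias_equiv_def)
    then have "?d p q \<in> induced_space (trias_equiv \<gamma>) 3"
      using pq unfolding induced_space_def by (intro span_base) blast
    then have "?d p q \<in> I 3" using R by blast
    \<comment> \<open>The subtrees are grafted on the difference in the same order as in the rule,
      from leaf 3 down to leaf 1.\<close>
    from left[OF left[OF left[OF this rel(4), of 3] rel(3), of 2] rel(2), of 1] show ?case
      using arity_pos[OF rel(2)] arity_pos[OF rel(3)] arity_pos[OF rel(4)] pq rel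
      by (simp add: graft_trias_trees[where \<gamma> = \<gamma>])
  qed
qed

text \<open>Modulo any ideal containing the relations, an element equals the normal form of its
  evaluation, which is 0 for an element of the kernel.\<close>

lemma generated_ideal_eq_kernel:
  "generated_ideal (trias_free \<gamma>) (induced_space (trias_equiv \<gamma>)) n =
    (word_kernel \<gamma> n :: (trias_op tree \<Rightarrow>\<^sub>0 'k::field) set)"
proof (intro equalityI subsetI)
  fix p :: "trias_op tree \<Rightarrow>\<^sub>0 'k"
  assume "p \<in> generated_ideal (trias_free \<gamma>) (induced_space (trias_equiv \<gamma>)) n"
  then show "p \<in> word_kernel \<gamma> n"
    using word_kernel_ideal induced_space_subset_kernel unfolding generated_ideal_def by blast
next
  fix p :: "trias_op tree \<Rightarrow>\<^sub>0 'k"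
  assume p: "p \<in> word_kernel \<gamma> n"
  have "p \<in> I n"
    if I: "is_operad_ideal (trias_free \<gamma>) I"
      and R: "\<forall>m. induced_space (trias_equiv \<gamma>) m \<subseteq> I m" for I
  proof -
    have sub: "0 \<in> I n" "\<And>x y. x \<in> I n \<Longrightarrow> y \<in> I n \<Longrightarrow> x + y \<in> I n"
      "\<And>c x. x \<in> I n \<Longrightarrow> pm_scale c x \<in> I n"
      using I by (auto simp: is_operad_ideal_def graded_subspace_def)
    have "Poly_Mapping.keys p \<subseteq> {t \<in> trias_trees \<gamma>. arity t = n}"
      using p by (simp add: word_kernel_def)
    \<comment> \<open>The claim is linear in \<open>p\<close>, and on a single tree it is
      \<open>cong_normal_form\<close>.\<close>
    then have "p - linear_extension normal_form (linear_extension word p) \<in> I n"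
    proof (induction p rule: poly_mapping_span_induct)
      case zero
      then show ?case using sub by simp
    next
      case (single t c)
      then have "Poly_Mapping.single t 1 - Poly_Mapping.single (normal_form (word t)) 1 \<in> I n"
        using trias_cong_in_ideal[OF I _ cong_normal_form] R by auto
      from sub(3)[OF this, of c] show ?case
        by (simp add: pm_scale_diff)
    next
      case (add p q)
      from sub(2)[OF this] show ?case
        by (simp add: linear_extension_add algebra_simps)
    qed
    with p show "p \<in> I n" by (simp add: word_kernel_def)
  qed
  then show "p \<in> generated_ideal (trias_free \<gamma>) (induced_space (trias_equiv \<gamma>)) n"
    unfolding generated_ideal_def by blast
qed

theorem theorem4p2p1:
  fixes \<gamma> :: nat
  shows "is_presentation (Trias \<gamma> :: ('k::field_char_0, nat list \<Rightarrow>\<^sub>0 'k) ns_operad)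
    (trias_gens \<gamma>) (induced_space (trias_equiv \<gamma>))"
proof -
  let ?P = "Trias \<gamma> :: ('k, nat list \<Rightarrow>\<^sub>0 'k) ns_operad"
  let ?F = "trias_free \<gamma> :: ('k, trias_op tree \<Rightarrow>\<^sub>0 'k) ns_operad"
  let ?I = "generated_ideal ?F (induced_space (trias_equiv \<gamma>))"
  let ?\<Phi> = "linear_extension word :: (trias_op tree \<Rightarrow>\<^sub>0 'k) \<Rightarrow> _"
  have P: "component ?P n = {p. Poly_Mapping.keys p \<subseteq> zero_words \<gamma> n}" "vadd ?P n = (+)"
    "vscale ?P n = pm_scale" "pcomp ?P n m i = bilinear_extension (word_comp i)"
    "opunit ?P = Poly_Mapping.single [0] 1" for n m i
    by (simp_all add: Trias_eq linear_operad_def)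
  have "operad_iso ?P (quotient_operad ?F ?I) (\<lambda>n p. {y \<in> component ?F n. ?\<Phi> y = p})"
  proof (rule operad_iso_fibres)
    fix n
    show "?\<Phi> ` component ?F n = component ?P n"
    proof (intro equalityI subsetI)
      fix p assume "p \<in> ?\<Phi> ` component ?F n"
      then show "p \<in> component ?P n"
        using word_in_zero_words by (fastforce simp: P dest!: subsetD[OF keys_linear_extension])
    next
      fix p assume "p \<in> component ?P n"
      then have p: "Poly_Mapping.keys p \<subseteq> zero_words \<gamma> n" by (simp add: P)
      \<comment> \<open>Replacing each word by its normal form gives a preimage under
        evaluation.\<close>
      then have "?\<Phi> (linear_extension normal_form p) = p"
        by (induction p rule: poly_mapping_span_induct)
          (simp_all add: linear_extension_add normal_form_zero_words)
      moreover have "linear_extension normal_form p \<in> component ?F n"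
        using p by (auto dest!: subsetD[OF keys_linear_extension] simp: normal_form_zero_words)
      ultimately show "p \<in> ?\<Phi> ` component ?F n" by force
    qed
  next
    fix n x
    assume x: "x \<in> component ?F n"
    \<comment> \<open>Two elements have equal evaluation exactly when their difference is in the
      kernel, which is the generated ideal.\<close>
    show "operad_coset ?F ?I n x = {y \<in> component ?F n. ?\<Phi> y = ?\<Phi> x}"
    proof (intro equalityI subsetI)
      fix y assume "y \<in> operad_coset ?F ?I n x"
      with x show "y \<in> {y \<in> component ?F n. ?\<Phi> y = ?\<Phi> x}"
        by (auto simp: operad_coset_def generated_ideal_eq_kernel word_kernel_def linear_extension_add
            dest!: subsetD[OF Poly_Mapping.keys_add])
    next
      fix y assume "y \<in> {y \<in> component ?F n. ?\<Phi> y = ?\<Phi> x}"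
      with x have "y - x \<in> ?I n"
        by (auto simp: generated_ideal_eq_kernel word_kernel_def linear_extension_diff
            dest!: subsetD[OF keys_diff])
      then show "y \<in> operad_coset ?F ?I n x"
        by (auto simp: operad_coset_def image_iff intro!: bexI[of _ "y - x"])
    qed
  next
    fix n m i x y
    assume "x \<in> component ?F n" "y \<in> component ?F m" "1 \<le> i" "i \<le> n"
    then show "pcomp ?F n m i x y \<in> component ?F (n + m - 1) \<and>
        ?\<Phi> (pcomp ?F n m i x y) = pcomp ?P n m i (?\<Phi> x) (?\<Phi> y)"
      using free_comp_closed[of x \<gamma> n y m i] word_comp_extension[of x \<gamma> n y m i]
      by (simp add: P del: trias_free_simps(1) One_nat_def)
  qed (auto simp: P linear_extension_add linear_extension_scale trees.Leaf
      dest!: subsetD[OF Poly_Mapping.keys_add] subsetD[OF keys_pm_scale])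
  moreover have "ns_operad ?P"
    unfolding Trias_eq by (rule ns_operad_zero_words)
  ultimately show ?thesis
    unfolding is_presentation_def using graded_subspace_induced_space by blast
qed

end
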